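(* Let $d \geq 3$ be an integer, let $q$ be a prime power, and let $G$ be a group with $\mathrm{SL}(d,q) \leq G \leq \mathrm{GL}(d,q)$. Let $\rho(G)$ denote the proportion of reducible fat pairs in the set of all pairs in $G \times G$, that is, $\rho(G) = |\{(g_1,g_2) \in G \times G : g_1, g_2 \text{ are fat and } (g_1,g_2) \text{ is reducible}\}| / |G|^2$. Then $$\rho(G) < q^{-d+1}.$$
   Context: $\mathrm{GL}(d,q)$ is the group of invertible $d \times d$ matrices over the finite field $\mathbb{F}_q$ of order $q$, and $\mathrm{SL}(d,q)$ is its subgroup of matrices of determinant $1$. Let $\mathcal{V} = \mathbb{F}_q^d$ be the space of row vectors of length $d$; every subgroup of $\mathrm{GL}(d,q)$ acts on $\mathcal{V}$ by right multiplication (vector times matrix), making $\mathcal{V}$ a right module (the natural module). An element $g \in \mathrm{GL}(d,q)$ is called fat if $\mathcal{V}$ has an irreducible $\mathbb{F}_q\langle g\rangle$-submodule of dimension $e > d/2$ for some integer $e$. A fat pair is a pair $(g_1,g_2)$ of fat elements. A pair $(g_1,g_2) \in \mathrm{GL}(d,q)\times \mathrm{GL}(d,q)$ is called reducible (respectively irreducible) if $\mathcal{V}$ is reducible (respectively irreducible) as an $\mathbb{F}_q\langle g_1,g_2\rangle$-module. *)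

theory Defs
  imports "HOL-Analysis.Analysis" "HOL-Algebra.Generated_Groups"
begin

text \<open>
  The field with \<open>q\<close> elements is a finite field type \<open>'a\<close>, with \<open>q = CARD('a)\<close>, and the
  dimension is \<open>d = CARD('n)\<close>. The natural module is the type \<open>'a^'n\<close> of row vectors, on
  which a matrix \<open>A\<close> acts on the right by \<open>\<lambda>v. v v* A\<close>.
\<close>

definition GL :: "('a::field^'n^'n) monoid" where
  "GL = \<lparr>carrier = {A. invertible A}, mult = (**), one = mat 1\<rparr>"

definition SL :: "('a::field^'n^'n) set" where
  "SL = {A. det A = 1}"

text \<open>
  For a group \<open>H\<close> of matrices, the submodules of the natural module over the group algebra of
  \<open>H\<close> are the linear subspaces that are invariant under every element of \<open>H\<close>.
\<close>

definition invariant_submodule :: "('a::field^'n^'n) set \<Rightarrow> ('a^'n) set \<Rightarrow> bool" where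
  "invariant_submodule H W \<longleftrightarrow> vec.subspace W \<and> (\<forall>h\<in>H. \<forall>v\<in>W. v v* h \<in> W)"

definition irreducible_submodule :: "('a::field^'n^'n) set \<Rightarrow> ('a^'n) set \<Rightarrow> bool" where
  "irreducible_submodule H W \<longleftrightarrow>
     invariant_submodule H W \<and> W \<noteq> {0} \<and>
     (\<forall>U. invariant_submodule H U \<and> U \<subseteq> W \<longrightarrow> U = {0} \<or> U = W)"

definition fat :: "('a::field^'n^'n) \<Rightarrow> bool" where
  "fat g \<longleftrightarrow> g \<in> carrier GL \<and>
     (\<exists>W. irreducible_submodule (generate GL {g}) W \<and> real (vec.dim W) > real CARD('n) / 2)"

definition reducible_pair :: "('a::field^'n^'n) \<Rightarrow> ('a^'n^'n) \<Rightarrow> bool" where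
  "reducible_pair g\<^sub>1 g\<^sub>2 \<longleftrightarrow> \<not> irreducible_submodule (generate GL {g\<^sub>1, g\<^sub>2}) UNIV"

definition reducible_fat_proportion :: "('a::field^'n^'n) set \<Rightarrow> real" where
  "reducible_fat_proportion G =
     real (card {(g\<^sub>1, g\<^sub>2) \<in> G \<times> G. fat g\<^sub>1 \<and> fat g\<^sub>2 \<and> reducible_pair g\<^sub>1 g\<^sub>2}) / real (card G) ^ 2"

end

theory Submission imports Defs "HOL-Computational_Algebra.Polynomial_Factorial" begin

text \<open>
  Write \<open>q\<close> for the order of the field and \<open>d\<close> for the dimension. A reducible pair of matrices has a
  common invariant subspace \<open>W\<close> of some dimension \<open>0 < k < d\<close>, so the number of reducible fat
  pairs is at most the sum over all \<open>W\<close> of \<open>f(W)\<^sup>2\<close>, where \<open>f(W)\<close> counts the fat elements in the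
  stabilizer \<open>G\<^sub>W\<close> of \<open>W\<close>. The proof bounds this sum directly.

  Orbits: \<open>SL\<close> is transitive on the \<open>c\<^sub>k\<close> subspaces of dimension \<open>k\<close>, hence
  \<open>|G\<^sub>W| \<le> |G| / c\<^sub>k\<close> (\<open>card_stabilizer_times_grassmannian_le\<close>).

  Fat elements in a stabilizer: let \<open>U\<close> be an irreducible submodule for \<open>g \<in> G\<^sub>W\<close>, of dimension
  \<open>e > d / 2\<close>. As \<open>U \<inter> W\<close> is invariant, \<open>U\<close> lies in \<open>W\<close> or meets it trivially; so \<open>k \<noteq> d / 2\<close> and
  \<open>e < d\<close>. For a nonzero \<open>v\<close> in \<open>U\<close> the vectors \<open>v, vg, \<dots>, vg\<^sup>e\<^sup>-\<^sup>1\<close> form a basis of \<open>U\<close> on which \<open>g\<close> acts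
  by the companion matrix of an irreducible polynomial of degree \<open>e\<close>. The stabilizer \<open>G\<^sub>W\<close> is
  transitive on such tuples; here \<open>e < d\<close> and \<open>0 < k < d\<close> leave room to correct determinants, which is
  why all groups between \<open>SL\<close> and \<open>GL\<close> behave alike. Counting orbit times stabilizer, each polynomial
  belongs to at most \<open>|G\<^sub>W|\<close> pairs \<open>(g, v)\<close> (\<open>card_cyclic_pairs_le\<close>). There are at most
  \<open>(q\<^sup>e - 1) / e\<close> monic irreducible polynomials of degree \<open>e\<close> (\<open>card_irreducible_le\<close>) and \<open>q\<^sup>e - 1\<close> vectors
  \<open>v\<close> for each \<open>g\<close>, so at most \<open>|G\<^sub>W| / e\<close> elements of \<open>G\<^sub>W\<close> have such a submodule. Summing over
  \<open>d / 2 < e < d\<close> gives \<open>f(W) \<le> p |G\<^sub>W|\<close> with \<open>p \<le> ln 2\<close>.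

  Numbers: the proportion is therefore at most the sum of \<open>p\<^sup>2 / c\<^sub>k\<close> over \<open>0 < k < d\<close> with
  \<open>k \<noteq> d / 2\<close>. The reciprocals \<open>1 / c\<^sub>k\<close> with \<open>k < d / 2\<close> add up to at most \<open>q\<^sup>1\<^sup>-\<^sup>d\<close>, and so do
  those with \<open>k > d / 2\<close> (\<open>sum_reciprocal_card_grassmannian_le\<close>). The conclusion follows from
  \<open>2 (ln 2)\<^sup>2 < 1\<close>; it is the restriction to fat pairs that makes the bound this small.
\<close>

section \<open>Independent lists and the number of subspaces\<close>

text \<open>
  Bases are lists, since orbits of vectors under powers of a matrix come in an order, and since
  tuples can be transported entry by entry.
\<close>

definition indep_list :: "('a::field^'n) list \<Rightarrow> bool" where
  "indep_list xs \<longleftrightarrow> distinct xs \<and> vec.independent (set xs)"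

lemma indep_list_Nil [simp]: "indep_list []"
  by (simp add: indep_list_def vec.independent_empty)

lemma indep_list_Cons: "indep_list (x # xs) \<longleftrightarrow> indep_list xs \<and> x \<notin> vec.span (set xs)"
  by (auto simp: indep_list_def vec.independent_insert vec.span_base)

lemma indep_list_append_commute: "indep_list (xs @ ys) \<longleftrightarrow> indep_list (ys @ xs)"
  by (auto simp: indep_list_def Un_commute)

lemma indep_list_snoc: "indep_list (xs @ [x]) \<longleftrightarrow> indep_list xs \<and> x \<notin> vec.span (set xs)"
  using indep_list_append_commute[of xs "[x]"] by (simp add: indep_list_Cons)

lemma indep_list_length_le:
  "indep_list xs \<Longrightarrow> set xs \<subseteq> W \<Longrightarrow> length xs \<le> vec.dim W"
  unfolding indep_list_def using vec.independent_card_le_dim[of "set xs" W] by (auto simp: distinct_card)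

lemma indep_list_dim: "indep_list xs \<Longrightarrow> vec.dim (set xs) = length xs"
  by (simp add: indep_list_def vec.dim_eq_card_independent distinct_card)

lemma indep_list_span_eq:
  assumes "indep_list xs" "set xs \<subseteq> W" "vec.subspace W" "length xs = vec.dim W"
  shows "vec.span (set xs) = W"
  by (rule vec.subspace_dim_equal)
     (use assms in \<open>auto simp: vec.subspace_span indep_list_dim vec.span_minimal\<close>)

lemma indep_list_extend:
  fixes xs :: "('a::field^'n) list"
  assumes "indep_list xs" "set xs \<subseteq> W" "vec.subspace W"
  obtains ys where "indep_list (xs @ ys)" "set ys \<subseteq> W" "length (xs @ ys) = vec.dim W"
    "vec.span (set (xs @ ys)) = W"
proof -
  obtain B where B: "set xs \<subseteq> B" "B \<subseteq> W" "vec.independent B" "W \<subseteq> vec.span B"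
    using vec.maximal_independent_subset_extend[of "set xs" W] assms by (auto simp: indep_list_def)
  have "finite B" using B(3) by (rule vec.finiteI_independent)
  then obtain ys where ys: "set ys = B - set xs" "distinct ys"
    using finite_distinct_list[of "B - set xs"] by auto
  have set: "set (xs @ ys) = B" using ys B by auto
  have ind: "indep_list (xs @ ys)" unfolding indep_list_def set
    using assms ys B by (auto simp: indep_list_def)
  have span: "vec.span B = W" using B assms(3) by (metis vec.span_subspace)
  show thesis
    by (rule that[OF ind])
      (use indep_list_dim[OF ind] span set ys B in auto)
qed

lemma subspace_basis_list:
  assumes "vec.subspace (W :: ('a::field^'n) set)"
  obtains ws where "indep_list ws" "length ws = vec.dim W" "vec.span (set ws) = W"
  using indep_list_extend[OF indep_list_Nil _ assms] by auto

lemma indep_list_extend_UNIV: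
  assumes "indep_list (xs :: ('a::field^'n) list)"
  obtains ys where "indep_list (xs @ ys)" "length (xs @ ys) = CARD('n)"
  using indep_list_extend[OF assms subset_UNIV vec.subspace_UNIV] by (auto simp: card_cart_basis)

lemma span_insert_image:
  "vec.span (insert x S) = (\<lambda>(c, s). c *s x + s) ` (UNIV \<times> vec.span S)"
proof (intro equalityI subsetI)
  fix y assume "y \<in> vec.span (insert x S)"
  then obtain c where "y - c *s x \<in> vec.span S" by (auto simp: vec.span_breakdown_eq)
  then show "y \<in> (\<lambda>(c, s). c *s x + s) ` (UNIV \<times> vec.span S)"
    by (intro image_eqI[of _ _ "(c, y - c *s x)"]) auto
qed (auto intro!: vec.span_add vec.span_scale intro: vec.span_base vec.span_mono[THEN subsetD, OF subset_insertI])

lemma card_span_indep_list: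
  fixes xs :: "('a::{field,finite}^'n) list"
  shows "indep_list xs \<Longrightarrow> card (vec.span (set xs)) = CARD('a) ^ length xs"
proof (induction xs)
  case (Cons x xs)
  have x: "x \<notin> vec.span (set xs)" and ind: "indep_list xs"
    using Cons.prems by (auto simp: indep_list_Cons)
  have "inj_on (\<lambda>(c, s). c *s x + s) (UNIV \<times> vec.span (set xs))"
  proof (rule inj_onI, clarsimp)
    fix c s c' s'
    assume s: "s \<in> vec.span (set xs)" "s' \<in> vec.span (set xs)" and eq: "c *s x + s = c' *s x + s'"
    have "(c - c') *s x = s' - s" using eq by (simp add: algebra_simps vec.scale_left_diff_distrib)
    then have *: "(c - c') *s x \<in> vec.span (set xs)" using s by (simp add: vec.span_diff)
    have "c = c'"
    proof (rule ccontr)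
      assume "c \<noteq> c'"
      then have "inverse (c - c') *s ((c - c') *s x) = x"
        by (simp only: vec.scale_scale left_inverse right_minus_eq not_False_eq_True vec.scale_one)
      then show False using x vec.span_scale[OF *, of "inverse (c - c')"] by simp
    qed
    then show "c = c' \<and> s = s'" using eq by simp
  qed
  then show ?case using Cons.IH[OF ind] by (simp add: span_insert_image card_image card_cartesian_product)
qed simp

lemma card_subspace:
  fixes W :: "('a::{field,finite}^'n) set"
  assumes "vec.subspace W"
  shows "card W = CARD('a) ^ vec.dim W"
proof -
  obtain ys where ys: "indep_list ys" "length ys = vec.dim W" "vec.span (set ys) = W"
    by (rule subspace_basis_list[OF assms])
  then show ?thesis using card_span_indep_list[of ys] by simp
qed

text \<open>
  Each new vector must avoid the span of the \<open>i\<close> vectors already chosen, which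
  has \<open>q ^ i\<close> elements.
\<close>

lemma card_indep_lists:
  fixes W :: "('a::{field,finite}^'n) set"
  assumes "vec.subspace W"
  shows "card {xs. length xs = m \<and> indep_list xs \<and> set xs \<subseteq> W}
    = (\<Prod>i<m. CARD('a) ^ vec.dim W - CARD('a) ^ i)"
proof (induction m)
  case 0
  have "{xs. length xs = 0 \<and> indep_list xs \<and> set xs \<subseteq> W} = {[]}" by auto
  then show ?case by simp
next
  case (Suc m)
  let ?L = "\<lambda>m. {xs. length xs = m \<and> indep_list xs \<and> set xs \<subseteq> W}"
  have eq: "?L (Suc m) = (\<lambda>(xs, x). x # xs) ` (SIGMA xs : ?L m. W - vec.span (set xs))"
    (is "_ = ?f ` ?S")
  proof (intro equalityI subsetI)
    fix zs assume "zs \<in> ?L (Suc m)"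
    then obtain x xs where zs: "zs = x # xs" "length xs = m" by (auto simp: length_Suc_conv)
    with \<open>zs \<in> ?L (Suc m)\<close> have "(xs, x) \<in> ?S" by (auto simp: indep_list_Cons)
    then show "zs \<in> ?f ` ?S" unfolding zs by force
  qed (auto simp: indep_list_Cons)
  have fin: "finite (?L m)"
    by (rule finite_subset[OF _ finite_lists_length_eq[of UNIV m]]) auto
  have cardd: "card (W - vec.span (set xs)) = CARD('a) ^ vec.dim W - CARD('a) ^ m"
    if "xs \<in> ?L m" for xs
  proof -
    have "vec.span (set xs) \<subseteq> W" using that assms by (simp add: vec.span_minimal)
    then have "card (W - vec.span (set xs)) = card W - card (vec.span (set xs))"
      by (intro card_Diff_subset) auto
    then show ?thesis using that by (simp add: card_subspace[OF assms] card_span_indep_list)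
  qed
  have "card (?L (Suc m)) = card ?S" unfolding eq by (rule card_image) (auto simp: inj_on_def)
  also have "\<dots> = (\<Sum>xs\<in>?L m. card (W - vec.span (set xs)))" using fin by (intro card_SigmaI) auto
  also have "\<dots> = card (?L m) * (CARD('a) ^ vec.dim W - CARD('a) ^ m)" using cardd by simp
  finally show ?case using Suc.IH by simp
qed

definition grassmannian :: "nat \<Rightarrow> ('a::field^'n) set set" where
  "grassmannian k = {W. vec.subspace W \<and> vec.dim W = k}"

text \<open>
  Both sides count the independent \<open>k\<close>-tuples of the whole space, on the left sorted by their
  span. The equation determines the Gaussian binomial coefficient without division.
\<close>

lemma card_grassmannian:
  "card (grassmannian k :: ('a::{field,finite}^'n) set set) * (\<Prod>i<k. CARD('a) ^ k - CARD('a) ^ i)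
    = (\<Prod>i<k. CARD('a) ^ CARD('n) - CARD('a) ^ i)"
proof -
  let ?B = "\<lambda>W::('a^'n) set. {xs. length xs = k \<and> indep_list xs \<and> set xs \<subseteq> W}"
  have fin: "finite (?B W)" for W
    by (rule finite_subset[OF _ finite_lists_length_eq[of UNIV k]]) auto
  have eq: "?B UNIV = (\<Union>W\<in>grassmannian k. ?B W)"
  proof (intro equalityI subsetI)
    fix xs :: "('a^'n) list" assume xs: "xs \<in> ?B UNIV"
    then have "vec.span (set xs) \<in> grassmannian k"
      by (auto simp: grassmannian_def vec.subspace_span indep_list_dim)
    then show "xs \<in> (\<Union>W\<in>grassmannian k. ?B W)" using xs vec.span_superset[of "set xs"] by blast
  qed auto
  have disj: "?B W \<inter> ?B W' = {}" if "W \<in> grassmannian k" "W' \<in> grassmannian k" "W \<noteq> W'" for W W'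
    using that indep_list_span_eq[of _ W] indep_list_span_eq[of _ W']
    by (fastforce simp: grassmannian_def)
  have "card (?B UNIV) = (\<Sum>W\<in>grassmannian k. card (?B W))"
    unfolding eq using fin disj by (intro card_UN_disjoint) auto
  also have "\<dots> = card (grassmannian k :: ('a^'n) set set) * (\<Prod>i<k. CARD('a) ^ k - CARD('a) ^ i)"
    by (simp add: card_indep_lists grassmannian_def)
  finally show ?thesis using card_indep_lists[of "UNIV :: ('a^'n) set" k] by (simp add: card_cart_basis)
qed

section \<open>Transitivity of the special linear group\<close>

lemma linear_vector_matrix: "Vector_Spaces.linear (*s) (*s) (\<lambda>v. v v* (A::'a::field^'n^'m))"
proof -
  have "(\<lambda>v. v v* A) = (*v) (Finite_Cartesian_Product.transpose A)" by (simp add: fun_eq_iff)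
  then show ?thesis by (simp only: matrix_vector_mul_linear_gen)
qed

lemma inj_vector_matrix:
  assumes "invertible (A::'a::field^'n^'n)"
  shows "inj (\<lambda>v. v v* A)"
proof (rule injI)
  fix v w assume "v v* A = w v* A"
  moreover obtain B where "A ** B = mat 1" using assms by (auto simp: invertible_def)
  ultimately show "v = w" by (metis vector_matrix_mul_assoc vector_matrix_mul_rid)
qed

lemma det_basis_rows_ne_0:
  fixes xs :: "('a::field^'n) list" and \<sigma> :: "'n \<Rightarrow> nat"
  assumes xs: "indep_list xs" "length xs = CARD('n)" and \<sigma>: "bij_betw \<sigma> UNIV {..<CARD('n)}"
  shows "det (\<chi> j. xs ! \<sigma> j) \<noteq> 0"
proof -
  let ?X = "\<chi> j. xs ! \<sigma> j"
  have bij: "bij_betw (\<lambda>j. xs ! \<sigma> j) UNIV (set xs)"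
    using bij_betw_trans[OF \<sigma> bij_betw_nth[of xs "{..<CARD('n)}" "set xs"]] xs
    by (simp add: indep_list_def comp_def)
  have "\<exists>B. ?X ** B = mat 1"
    unfolding matrix_right_invertible_independent_rows
  proof (intro allI impI)
    fix c :: "'n \<Rightarrow> 'a" and i
    assume c: "(\<Sum>i\<in>UNIV. c i *s row i ?X) = 0"
    let ?t = "the_inv (\<lambda>j. xs ! \<sigma> j)"
    have inj: "inj (\<lambda>j. xs ! \<sigma> j)" using bij by (simp add: bij_betw_def)
    have "(\<Sum>v\<in>set xs. c (?t v) *s v) = (\<Sum>j\<in>UNIV. c j *s (xs ! \<sigma> j))"
      by (subst sum.reindex_bij_betw[OF bij, symmetric]) (simp add: the_inv_f_f[OF inj])
    also have "\<dots> = 0" using c by (simp add: row_def vec_nth_inverse)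
    finally have "c (?t (xs ! \<sigma> i)) = 0"
      using xs bij by (intro vec.independentD[of "set xs"]) (auto simp: indep_list_def bij_betw_def)
    then show "c i = 0" by (simp add: the_inv_f_f[OF inj])
  qed
  then show ?thesis by (metis invertible_det_nz invertible_right_inverse)
qed

lemma row_mult: "row i (A ** B) = row i A v* (B::'a::comm_semiring_1^'k^'m)"
  by (simp add: row_def vector_matrix_mult_def matrix_matrix_mult_def vec_eq_iff)

text \<open>
  With \<open>X\<close> and \<open>Y\<close> the matrices whose rows are the two bases, \<open>X\<^sup>-\<^sup>1Y\<close> carries one basis
  to the other. Rescaling a single row of \<open>Y\<close> adjusts the determinant to 1. The position of the
  rescaled row is free, so that each application below can choose a row where the scalar is
  harmless.
\<close>

lemma SL_maps_basis_up_to_scalar: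
  fixes xs ys :: "('a::field^'n) list"
  assumes xs: "indep_list xs" "length xs = CARD('n)" and ys: "indep_list ys" "length ys = CARD('n)"
    and i0: "i0 < CARD('n)"
  obtains A :: "'a^'n^'n" and c where "A \<in> SL" "\<And>i. i < CARD('n) \<Longrightarrow> i \<noteq> i0 \<Longrightarrow> xs ! i v* A = ys ! i"
    "xs ! i0 v* A = c *s (ys ! i0)"
proof -
  obtain \<sigma> :: "'n \<Rightarrow> nat" where \<sigma>: "bij_betw \<sigma> UNIV {..<CARD('n)}"
    using ex_bij_betw_finite_nat[of "UNIV :: 'n set"] by (auto simp: atLeast0LessThan)
  obtain j0 where j0: "\<sigma> j0 = i0" using \<sigma> i0 by (metis bij_betw_iff_bijections lessThan_iff)
  let ?X = "\<chi> j. xs ! \<sigma> j" and ?Y = "\<chi> j. ys ! \<sigma> j"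
  \<comment> \<open>The row scaling that makes the determinants of the two basis matrices equal.\<close>
  define c where "c = det ?X / det ?Y"
  let ?Z = "\<chi> j. if j = j0 then c *s (ys ! \<sigma> j) else ys ! \<sigma> j"
  have X: "det ?X \<noteq> 0" and Y: "det ?Y \<noteq> 0"
    using det_basis_rows_ne_0 \<sigma> xs ys by blast+
  obtain X' where X': "X' ** ?X = mat 1" "?X ** X' = mat 1"
    using X unfolding invertible_det_nz[symmetric] invertible_def by blast
  let ?A = "X' ** ?Z"
  have "det ?Z = c * det ?Y" by (subst det_row_mul) simp
  also have "\<dots> = det ?X" using Y by (simp add: c_def)
  finally have "det ?Z = det ?X" .
  moreover have "det X' * det ?X = 1" using X' by (metis det_mul det_I)
  ultimately have "?A \<in> SL" by (simp add: SL_def det_mul)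
  have rows: "xs ! \<sigma> j v* ?A = ?Z $ j" for j
  proof -
    have "?X ** ?A = ?Z" by (simp add: matrix_mul_assoc X')
    then have "row j ?X v* ?A = row j ?Z" by (simp only: row_mult[symmetric])
    then show ?thesis by (simp add: row_def)
  qed
  show thesis
  proof (rule that[OF \<open>?A \<in> SL\<close>])
    fix i assume i: "i < CARD('n)" "i \<noteq> i0"
    obtain j where "\<sigma> j = i" using \<sigma> i by (metis bij_betw_iff_bijections lessThan_iff)
    then show "xs ! i v* ?A = ys ! i" using rows[of j] i j0 by auto
  next
    show "xs ! i0 v* ?A = c *s (ys ! i0)" using rows[of j0] j0 by simp
  qed
qed

lemma vector_matrix_image_span_subset:
  assumes "vec.subspace W" "\<And>v. v \<in> S \<Longrightarrow> v v* A \<in> W"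
  shows "\<forall>v\<in>vec.span S. v v* A \<in> W"
proof -
  interpret Vector_Spaces.linear "(*s)" "(*s)" "\<lambda>v. v v* A" by (rule linear_vector_matrix)
  have "(\<lambda>v. v v* A) ` vec.span S = vec.span ((\<lambda>v. v v* A) ` S)" by (simp add: span_image)
  also have "\<dots> \<subseteq> W" using assms by (intro vec.span_minimal) auto
  finally show ?thesis by auto
qed

lemma SL_maps_subspace:
  fixes W W' :: "('a::field^'n) set"
  assumes W: "W \<in> grassmannian k" and W': "W' \<in> grassmannian k"
  obtains h :: "'a^'n^'n" where "h \<in> SL" "\<forall>w\<in>W. w v* h \<in> W'"
proof -
  have sub: "vec.subspace W" "vec.dim W = k" and sub': "vec.subspace W'" "vec.dim W' = k"
    using W W' by (simp_all add: grassmannian_def)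
  obtain us where us: "indep_list us" "length us = k" "vec.span (set us) = W"
    using subspace_basis_list[OF sub(1)] sub(2) by metis
  obtain us' where us': "indep_list us'" "length us' = k" "vec.span (set us') = W'"
    using subspace_basis_list[OF sub'(1)] sub'(2) by metis
  obtain r where r: "indep_list (us @ r)" "length (us @ r) = CARD('n)"
    by (rule indep_list_extend_UNIV[OF us(1)])
  obtain r' where r': "indep_list (us' @ r')" "length (us' @ r') = CARD('n)"
    by (rule indep_list_extend_UNIV[OF us'(1)])
  obtain A c where A: "A \<in> SL" "\<And>i. i < CARD('n) \<Longrightarrow> i \<noteq> 0 \<Longrightarrow> (us @ r) ! i v* A = (us' @ r') ! i"
    "(us @ r) ! 0 v* A = c *s ((us' @ r') ! 0)"
    by (rule SL_maps_basis_up_to_scalar[OF r r' zero_less_card_finite]) blast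
  have in': "us' ! i \<in> W'" if "i < k" for i
    using that us' vec.span_superset[of "set us'"] by auto
  have "us ! i v* A \<in> W'" if "i < k" for i
  proof (cases "i = 0")
    case True
    then show ?thesis using A(3) us us' in'[of i] that sub'(1)
      by (simp add: nth_append vec.subspace_scale)
  next
    case False
    then show ?thesis using A(2)[of i] us us' in'[of i] that r
      by (simp add: nth_append)
  qed
  then have "\<forall>w\<in>vec.span (set us). w v* A \<in> W'"
    using us by (intro vector_matrix_image_span_subset sub'(1)) (auto simp: in_set_conv_nth)
  then show thesis using that A(1) us by simp
qed

text \<open>
  Both tuples extend to bases of \<open>W\<close> and then of the whole space. The determinant is corrected on
  a basis vector outside \<open>W\<close>, which exists as \<open>W\<close> is proper.
\<close>

lemma SL_stabilizer_transitive_inside: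
  fixes W :: "('a::field^'n) set"
  assumes W: "vec.subspace W" "vec.dim W < CARD('n)"
    and b: "indep_list b" "set b \<subseteq> W" and b': "indep_list b'" "set b' \<subseteq> W" "length b' = length b"
  obtains h :: "'a^'n^'n" where "h \<in> SL" "\<forall>w\<in>W. w v* h \<in> W" "map (\<lambda>v. v v* h) b = b'"
proof -
  obtain r where r: "indep_list (b @ r)" "set r \<subseteq> W" "length (b @ r) = vec.dim W" "vec.span (set (b @ r)) = W"
    by (rule indep_list_extend[OF b W(1)])
  obtain r' where r': "indep_list (b' @ r')" "set r' \<subseteq> W" "length (b' @ r') = vec.dim W"
    by (rule indep_list_extend[OF b'(1,2) W(1)])
  obtain s where s: "indep_list ((b @ r) @ s)" "length ((b @ r) @ s) = CARD('n)"
    by (rule indep_list_extend_UNIV[OF r(1)])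
  obtain s' where s': "indep_list ((b' @ r') @ s')" "length ((b' @ r') @ s') = CARD('n)"
    by (rule indep_list_extend_UNIV[OF r'(1)])
  let ?k = "vec.dim W"
  obtain A where A: "A \<in> SL"
    "\<And>i. i < CARD('n) \<Longrightarrow> i \<noteq> ?k \<Longrightarrow> ((b @ r) @ s) ! i v* A = ((b' @ r') @ s') ! i"
    by (rule SL_maps_basis_up_to_scalar[OF s s' W(2)]) blast
  have br: "(b @ r) ! i v* A = (b' @ r') ! i" if "i < ?k" for i
    using A(2)[of i] that r(3) r'(3) W(2) by (simp add: nth_append_left del: append_assoc)
  have "(b @ r) ! i v* A \<in> W" if "i < ?k" for i
    using br[OF that] that r'(2,3) b' nth_mem[of i "b' @ r'"] by auto
  then have "\<forall>w\<in>vec.span (set (b @ r)). w v* A \<in> W"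
    using r(3) by (intro vector_matrix_image_span_subset W(1)) (metis in_set_conv_nth)
  moreover have "map (\<lambda>v. v v* A) b = b'"
  proof (rule nth_equalityI)
    fix i assume "i < length (map (\<lambda>v. v v* A) b)"
    then show "map (\<lambda>v. v v* A) b ! i = b' ! i"
      using br[of i] r(3) b'(3) by (simp add: nth_append_left)
  qed (use b' in simp)
  ultimately show thesis using that A(1) r(4) by metis
qed

text \<open>
  For tuples that are independent modulo \<open>W\<close>, a basis vector outside both \<open>W\<close> and the tuple need
  not exist. The determinant is therefore corrected on the first vector of the basis \<open>ws\<close> of \<open>W\<close>,
  which keeps the line of that vector and hence \<open>W\<close>.
\<close>

lemma SL_stabilizer_transitive_outside:
  fixes W :: "('a::field^'n) set"
  assumes ws: "vec.span (set ws) = W" "ws \<noteq> []"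
    and b: "indep_list (ws @ b)" and b': "indep_list (ws @ b')" "length b' = length b"
  obtains h :: "'a^'n^'n" where "h \<in> SL" "\<forall>w\<in>W. w v* h \<in> W" "map (\<lambda>v. v v* h) b = b'"
proof -
  have W: "vec.subspace W" using ws(1) by (metis vec.subspace_span)
  obtain s where s: "indep_list ((ws @ b) @ s)" "length ((ws @ b) @ s) = CARD('n)"
    by (rule indep_list_extend_UNIV[OF b(1)])
  obtain s' where s': "indep_list ((ws @ b') @ s')" "length ((ws @ b') @ s') = CARD('n)"
    by (rule indep_list_extend_UNIV[OF b'(1)])
  obtain A c where A: "A \<in> SL"
    "\<And>i. i < CARD('n) \<Longrightarrow> i \<noteq> 0 \<Longrightarrow> ((ws @ b) @ s) ! i v* A = ((ws @ b') @ s') ! i"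
    "((ws @ b) @ s) ! 0 v* A = c *s (((ws @ b') @ s') ! 0)"
    by (rule SL_maps_basis_up_to_scalar[OF s s' zero_less_card_finite]) blast
  have wsW: "ws ! i \<in> W" if "i < length ws" for i
    using that ws vec.span_superset[of "set ws"] by auto
  have "ws ! i v* A \<in> W" if "i < length ws" for i
  proof (cases "i = 0")
    case True
    then show ?thesis using A(3) wsW[OF that] that W
      by (simp add: nth_append_left vec.subspace_scale)
  next
    case False
    then show ?thesis using A(2)[of i] wsW[OF that] that s
      by (simp add: nth_append_left)
  qed
  then have "\<forall>w\<in>vec.span (set ws). w v* A \<in> W"
    by (intro vector_matrix_image_span_subset W) (metis in_set_conv_nth)
  moreover have "map (\<lambda>v. v v* A) b = b'"
  proof (rule nth_equalityI)
    fix i assume "i < length (map (\<lambda>v. v v* A) b)"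
    then show "map (\<lambda>v. v v* A) b ! i = b' ! i"
      using A(2)[of "length ws + i"] b'(2) ws(2) s by (simp add: nth_append)
  qed (use b' in simp)
  ultimately show thesis using that A(1) ws(1) by metis
qed

section \<open>Cyclic bases of irreducible submodules\<close>

lemma GL_simps [simp]: "carrier GL = {A. invertible A}" "x \<otimes>\<^bsub>GL\<^esub> y = x ** y" "\<one>\<^bsub>GL\<^esub> = mat 1"
  by (simp_all add: GL_def)

lemma group_GL: "group (GL :: ('a::field^'n^'n) monoid)"
proof (rule groupI)
  fix x :: "'a^'n^'n" assume "x \<in> carrier GL"
  then obtain y where "x ** y = mat 1" "y ** x = mat 1" by (auto simp: invertible_def)
  then show "\<exists>y\<in>carrier GL. y \<otimes>\<^bsub>GL\<^esub> x = \<one>\<^bsub>GL\<^esub>" by (auto simp: invertible_def)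
next
  fix x y :: "'a^'n^'n" assume "x \<in> carrier GL" "y \<in> carrier GL"
  then show "x \<otimes>\<^bsub>GL\<^esub> y \<in> carrier GL" by (simp add: invertible_mult)
qed (auto simp: matrix_mul_assoc invertible_def)

lemma GL_inv:
  assumes "invertible (g :: 'a::field^'n^'n)"
  shows "inv\<^bsub>GL\<^esub> g ** g = mat 1" "g ** inv\<^bsub>GL\<^esub> g = mat 1" "invertible (inv\<^bsub>GL\<^esub> g)"
  using group.l_inv[OF group_GL, of g] group.r_inv[OF group_GL, of g] group.inv_closed[OF group_GL, of g] assms
  by auto

lemma image_subspace_eq:
  fixes g :: "'a::{field,finite}^'n^'n"
  assumes "invertible g" "\<forall>v\<in>W. v v* g \<in> W"
  shows "(\<lambda>v. v v* g) ` W = W"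
  using assms inj_vector_matrix[OF assms(1)]
  by (intro endo_inj_surj) (auto intro: inj_on_subset)

text \<open>
  By finiteness \<open>g\<close> permutes \<open>W\<close>, so closure under \<open>g\<close> alone gives closure under its inverse.
  Consequently invariance under a generated group can be tested on the generators.
\<close>

lemma inv_preserves:
  fixes g :: "'a::{field,finite}^'n^'n"
  assumes "invertible g" "\<forall>v\<in>W. v v* g \<in> W" "w \<in> W"
  shows "w v* inv\<^bsub>GL\<^esub> g \<in> W"
proof -
  obtain u where "u \<in> W" "w = u v* g" using image_subspace_eq[OF assms(1,2)] assms(3) by auto
  then show ?thesis using assms(1) by (simp add: vector_matrix_mul_assoc GL_inv)
qed

lemma generate_preserves:
  fixes S :: "('a::{field,finite}^'n^'n) set"
  assumes "S \<subseteq> carrier GL" "\<forall>g\<in>S. \<forall>v\<in>W. v v* g \<in> W" "h \<in> generate GL S"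
  shows "\<forall>v\<in>W. v v* h \<in> W"
  using assms(3)
proof induction
  case one
  then show ?case by simp
next
  case (incl h)
  then show ?case using assms(2) by blast
next
  case (inv h)
  then have "invertible h" "\<forall>v\<in>W. v v* h \<in> W" using assms(1,2) by auto
  then show ?case using inv_preserves by blast
next
  case (eng h1 h2)
  then show ?case by (simp add: vector_matrix_mul_assoc[symmetric])
qed

lemma irreducible_submoduleD:
  fixes g :: "'a::{field,finite}^'n^'n"
  assumes "irreducible_submodule (generate GL {g}) U" "invertible g"
  shows "vec.subspace U" "U \<noteq> {0}" "\<forall>v\<in>U. v v* g \<in> U"
    "\<And>X. vec.subspace X \<Longrightarrow> \<forall>v\<in>X. v v* g \<in> X \<Longrightarrow> X \<subseteq> U \<Longrightarrow> X = {0} \<or> X = U"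
proof -
  have U: "invariant_submodule (generate GL {g}) U" "U \<noteq> {0}"
    and min: "\<And>X. invariant_submodule (generate GL {g}) X \<Longrightarrow> X \<subseteq> U \<Longrightarrow> X = {0} \<or> X = U"
    using assms(1) unfolding irreducible_submodule_def by blast+
  show "vec.subspace U" "U \<noteq> {0}" "\<forall>v\<in>U. v v* g \<in> U"
    using U generate.incl[of g "{g}" GL] unfolding invariant_submodule_def by blast+
  fix X assume X: "vec.subspace X" "\<forall>v\<in>X. v v* g \<in> X" "X \<subseteq> U"
  have "\<forall>v\<in>X. v v* h \<in> X" if "h \<in> generate GL {g}" for h
    using generate_preserves[of "{g}" X h] assms(2) X(2) that by simp
  then show "X = {0} \<or> X = U"
    using min[of X] X(1,3) unfolding invariant_submodule_def by blast
qed

text \<open>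
  Iteration of the map stands for a matrix power, because the power operation on the type of matrices
  is componentwise.
\<close>

definition krylov :: "('a::field^'n^'n) \<Rightarrow> 'a^'n \<Rightarrow> nat \<Rightarrow> ('a^'n) list" where
  "krylov g v m = map (\<lambda>i. ((\<lambda>v. v v* g) ^^ i) v) [0..<m]"

lemma length_krylov [simp]: "length (krylov g v m) = m"
  by (simp add: krylov_def)

lemma krylov_Suc: "krylov g v (Suc m) = krylov g v m @ [((\<lambda>v. v v* g) ^^ m) v]"
  by (simp add: krylov_def)

lemma nth_krylov: "i < m \<Longrightarrow> krylov g v m ! i = ((\<lambda>v. v v* g) ^^ i) v"
  by (simp add: krylov_def)

lemma krylov_preserved:
  assumes "\<forall>v\<in>U. v v* g \<in> U" "v \<in> U"
  shows "((\<lambda>v. v v* g) ^^ i) v \<in> U" "set (krylov g v m) \<subseteq> U"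
proof -
  show *: "((\<lambda>v. v v* g) ^^ i) v \<in> U" for i using assms by (induction i) auto
  show "set (krylov g v m) \<subseteq> U" using * by (auto simp: krylov_def)
qed

text \<open>
  Up to the first linear dependence \<open>v, vg, vg\<^sup>2, \<dots>\<close> are independent, and their span is then closed
  under \<open>g\<close>; by irreducibility it is all of \<open>U\<close>.
\<close>

lemma krylov_basis_of_irreducible:
  fixes g :: "'a::{field,finite}^'n^'n"
  assumes irr: "irreducible_submodule (generate GL {g}) U" and g: "invertible g"
    and v: "v \<in> U" "v \<noteq> 0"
  shows "indep_list (krylov g v (vec.dim U))" "vec.span (set (krylov g v (vec.dim U))) = U"
proof -
  note U = irreducible_submoduleD[OF irr g]
  let ?K = "krylov g v"
  have "\<exists>m. indep_list (?K m) \<and> \<not> indep_list (?K (Suc m))"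
  proof (rule ccontr)
    assume "\<not> ?thesis"
    then have "indep_list (?K m)" for m by (induction m) (auto simp: krylov_def)
    from indep_list_length_le[OF this[of "Suc CARD('n)"] subset_UNIV] show False
      by (simp add: card_cart_basis)
  qed
  then obtain m where m: "indep_list (?K m)" "((\<lambda>v. v v* g) ^^ m) v \<in> vec.span (set (?K m))"
    by (auto simp: krylov_Suc indep_list_snoc)
  let ?S = "vec.span (set (?K m))"
  have "\<forall>w\<in>?S. w v* g \<in> ?S"
  proof (rule vector_matrix_image_span_subset)
    fix w assume "w \<in> set (?K m)"
    then obtain i where i: "i < m" "w = ((\<lambda>v. v v* g) ^^ i) v" by (auto simp: krylov_def)
    show "w v* g \<in> ?S"
    proof (cases "Suc i = m")
      case True
      then show ?thesis using m(2) i by auto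
    next
      case False
      then have "w v* g \<in> set (?K m)" using i by (auto simp: krylov_def intro!: image_eqI[of _ _ "Suc i"])
      then show ?thesis by (rule vec.span_base)
    qed
  qed (rule vec.subspace_span)
  moreover have "?S \<subseteq> U" using krylov_preserved(2)[OF U(3) v(1)] U(1) by (rule vec.span_minimal)
  moreover have "?S \<noteq> {0}"
  proof (cases m)
    case 0
    then show ?thesis using m(2) v(2) by (simp add: krylov_def)
  next
    case (Suc m')
    then have "?K m ! 0 \<in> set (?K m)" by (intro nth_mem) simp
    then have "v \<in> set (?K m)" using Suc by (simp add: nth_krylov)
    then show ?thesis using v(2) vec.span_base by blast
  qed
  ultimately have "?S = U" using U(4)[of ?S] by auto
  moreover have "vec.dim U = m" using indep_list_dim[OF m(1)] calculation by (metis length_krylov vec.dim_span)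
  ultimately show "indep_list (?K (vec.dim U))" "vec.span (set (?K (vec.dim U))) = U" using m by auto
qed

lemma indep_list_sum_eq_0D:
  assumes xs: "indep_list xs" and 0: "(\<Sum>i<length xs. c i *s (xs ! i)) = 0" and i: "i < length xs"
  shows "c i = 0"
proof -
  have bij: "bij_betw (\<lambda>i. xs ! i) {..<length xs} (set xs)"
    using xs by (intro bij_betw_nth) (auto simp: indep_list_def)
  let ?t = "the_inv_into {..<length xs} (\<lambda>i. xs ! i)"
  have inj: "inj_on (\<lambda>i. xs ! i) {..<length xs}" using bij by (simp add: bij_betw_def)
  have "(\<Sum>v\<in>set xs. c (?t v) *s v) = (\<Sum>i<length xs. c i *s (xs ! i))"
    by (subst sum.reindex_bij_betw[OF bij, symmetric]) (simp add: the_inv_into_f_f[OF inj])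
  then have "c (?t (xs ! i)) = 0"
    using xs i 0 by (intro vec.independentD[of "set xs"]) (auto simp: indep_list_def)
  then show ?thesis using i by (simp add: the_inv_into_f_f[OF inj])
qed

lemma span_list_coefficients:
  assumes xs: "distinct xs" and v: "v \<in> vec.span (set xs)"
  obtains c where "v = (\<Sum>i<length xs. c i *s (xs ! i))"
proof -
  have bij: "bij_betw (\<lambda>i. xs ! i) {..<length xs} (set xs)"
    using xs by (intro bij_betw_nth) auto
  obtain u where "v = (\<Sum>w\<in>set xs. u w *s w)" using v by (auto simp: vec.span_finite)
  then have "v = (\<Sum>i<length xs. u (xs ! i) *s (xs ! i))"
    by (subst (asm) sum.reindex_bij_betw[OF bij, symmetric])
  then show thesis by (rule that)
qed

text \<open>
  The vector \<open>v p(g)\<close>, evaluated by Horner's scheme.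
\<close>

definition poly_apply :: "('a::field^'n^'n) \<Rightarrow> 'a poly \<Rightarrow> 'a^'n \<Rightarrow> 'a^'n" where
  "poly_apply g p v = fold_coeffs (\<lambda>a w. a *s v + w v* g) p 0"

lemma poly_apply_0 [simp]: "poly_apply g 0 v = 0"
  by (simp add: poly_apply_def)

lemma poly_apply_pCons: "poly_apply g (pCons a p) v = a *s v + poly_apply g p v v* g"
  by (cases "a = 0 \<and> p = 0") (auto simp: poly_apply_def fold_coeffs_pCons_eq)

lemma poly_apply_add: "poly_apply g (p + q) v = poly_apply g p v + poly_apply g q v"
  by (induction p q rule: poly_induct2)
     (simp_all add: poly_apply_pCons vector_matrix_left_distrib vec.scale_left_distrib algebra_simps)

lemma poly_apply_smult: "poly_apply g (smult c p) v = c *s poly_apply g p v"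
  by (induction p)
     (simp_all add: poly_apply_pCons scalar_vector_matrix_assoc vec.scale_right_distrib)

lemma poly_apply_mult: "poly_apply g (p * q) v = poly_apply g p (poly_apply g q v)"
  by (induction p) (simp_all add: poly_apply_add poly_apply_smult poly_apply_pCons)

lemma poly_apply_mem:
  assumes "vec.subspace U" "\<forall>v\<in>U. v v* g \<in> U" "v \<in> U"
  shows "poly_apply g p v \<in> U"
  using assms by (induction p) (auto simp: poly_apply_pCons vec.subspace_0 intro!: vec.subspace_add vec.subspace_scale)

lemma sum_vector_matrix: "(\<Sum>i\<in>A. f i) v* g = (\<Sum>i\<in>A. f i v* (g::'a::field^'n^'m))"
proof -
  interpret Vector_Spaces.linear "(*s)" "(*s)" "\<lambda>v. v v* g" by (rule linear_vector_matrix)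
  show ?thesis by (rule sum)
qed

lemma poly_apply_eq_sum:
  assumes "\<And>i. i \<ge> m \<Longrightarrow> coeff p i = 0"
  shows "poly_apply g p v = (\<Sum>i<m. coeff p i *s ((\<lambda>v. v v* g) ^^ i) v)"
  using assms
proof (induction p arbitrary: m)
  case (pCons a p)
  show ?case
  proof (cases m)
    case 0
    then have "pCons a p = 0" using pCons.prems by (intro poly_eqI) simp
    then show ?thesis using pCons.hyps by simp
  next
    case (Suc m')
    have "coeff p i = 0" if "i \<ge> m'" for i using pCons.prems[of "Suc i"] that Suc by simp
    from pCons.IH[OF this]
    show ?thesis unfolding Suc
      by (simp add: poly_apply_pCons sum.lessThan_Suc_shift sum_vector_matrix
          scalar_vector_matrix_assoc del: sum.lessThan_Suc)
  qed
qed simp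

lemma poly_apply_ne_0:
  fixes g :: "'a::{field,finite}^'n^'n"
  assumes irr: "irreducible_submodule (generate GL {g}) U" and g: "invertible g"
    and v: "v \<in> U" "v \<noteq> 0" and p: "p \<noteq> 0" "degree p < vec.dim U"
  shows "poly_apply g p v \<noteq> 0"
proof
  assume 0: "poly_apply g p v = 0"
  let ?K = "krylov g v (vec.dim U)"
  have "poly_apply g p v = (\<Sum>i<length ?K. coeff p i *s (?K ! i))"
    using p(2) by (subst poly_apply_eq_sum[of "vec.dim U"]) (auto simp: nth_krylov coeff_eq_0)
  then have "coeff p (degree p) = 0"
    using indep_list_sum_eq_0D[OF krylov_basis_of_irreducible(1)[OF irr g v], of "coeff p"] 0 p(2) by simp
  then show False using p(1) by simp
qed

text \<open>
  Expressing \<open>vg\<^sup>e\<close> in the cyclic basis of \<open>v\<close> gives a monic annihilator \<open>f\<close> of degree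
  \<open>e = dim U\<close>. It is irreducible because polynomials of smaller degree do not kill any nonzero
  vector of \<open>U\<close>: applying the factors of a proper factorization one after the other would
  never reach 0.
\<close>

lemma annihilator_of_irreducible:
  fixes g :: "'a::{field,finite}^'n^'n"
  assumes irr: "irreducible_submodule (generate GL {g}) U" and g: "invertible g"
    and v: "v \<in> U" "v \<noteq> 0"
  obtains f where "lead_coeff f = 1" "degree f = vec.dim U" "irreducible f" "poly_apply g f v = 0"
proof -
  note U = irreducible_submoduleD[OF irr g]
  let ?e = "vec.dim U" let ?K = "krylov g v ?e"
  note K = krylov_basis_of_irreducible[OF irr g v]
  obtain c where c: "((\<lambda>v. v v* g) ^^ ?e) v = (\<Sum>i<length ?K. c i *s (?K ! i))"
    by (rule span_list_coefficients[of ?K]) (use K krylov_preserved(1)[OF U(3) v(1)] in \<open>auto simp: indep_list_def\<close>)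
  define f where "f = monom 1 ?e - (\<Sum>i<?e. monom (c i) i)"
  have coeff: "coeff f i = (if i = ?e then 1 else if i < ?e then - c i else 0)" for i
    by (simp add: f_def coeff_sum)
  have deg: "degree f = ?e" by (rule antisym) (auto intro!: degree_le le_degree simp: coeff)
  have lead: "lead_coeff f = 1" by (simp add: deg coeff)
  have "poly_apply g f v = (\<Sum>i<Suc ?e. coeff f i *s ((\<lambda>v. v v* g) ^^ i) v)"
    by (rule poly_apply_eq_sum) (simp add: coeff)
  also have "\<dots> = 0" using c by (simp add: coeff nth_krylov vec.scale_minus_left sum_negf)
  finally have 0: "poly_apply g f v = 0" .
  have "\<not> U \<subseteq> {0}" using U(2) vec.subspace_0[OF U(1)] by blast
  then have e: "?e > 0" using vec.dim_eq_0[of U] by blast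
  have "irreducible f"
  proof (rule irreducibleI)
    show "f \<noteq> 0" using lead by auto
    show "\<not> is_unit f" using deg e is_unit_iff_degree[OF \<open>f \<noteq> 0\<close>] by (metis less_irrefl)
    fix a b assume f: "f = a * b"
    have nz: "a \<noteq> 0" "b \<noteq> 0" using f \<open>f \<noteq> 0\<close> by auto
    show "is_unit a \<or> is_unit b"
    proof (rule ccontr)
      assume "\<not> ?thesis"
      then have d: "degree a > 0" "degree b > 0" using nz by (auto simp: is_unit_iff_degree)
      have "degree a + degree b = ?e" using f nz deg by (simp add: degree_mult_eq)
      then have lt: "degree a < ?e" "degree b < ?e" using d by auto
      have "poly_apply g b v \<noteq> 0" "poly_apply g b v \<in> U"
        using poly_apply_ne_0[OF irr g v nz(2) lt(2)] poly_apply_mem[OF U(1,3) v(1)] by auto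
      then have "poly_apply g a (poly_apply g b v) \<noteq> 0"
        using poly_apply_ne_0[OF irr g _ _ nz(1) lt(1)] by blast
      then show False using 0 f by (simp add: poly_apply_mult)
    qed
  qed
  then show thesis using that lead deg 0 by blast
qed

text \<open>
  The action of \<open>g\<close> on its cyclic basis is determined by the basis and the annihilator: it is
  the companion matrix of \<open>f\<close>.
\<close>

lemma next_krylov:
  assumes f: "lead_coeff f = 1" "degree f = e" "poly_apply g f v = 0" and i: "i < e"
  shows "krylov g v e ! i v* g
    = (if Suc i < e then krylov g v e ! Suc i else - (\<Sum>i<e. coeff f i *s (krylov g v e ! i)))"
proof (cases "Suc i < e")
  case False
  then have e: "e = Suc i" using i by simp
  have "0 = (\<Sum>i<Suc e. coeff f i *s ((\<lambda>v. v v* g) ^^ i) v)"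
    using poly_apply_eq_sum[of "Suc e" f g v] f by (auto simp: coeff_eq_0)
  also have "\<dots> = (\<Sum>i<e. coeff f i *s (krylov g v e ! i)) + ((\<lambda>v. v v* g) ^^ e) v"
    using f(1,2) by (simp add: nth_krylov)
  finally have "((\<lambda>v. v v* g) ^^ e) v = - (\<Sum>i<e. coeff f i *s (krylov g v e ! i))"
    by (metis add.commute add_eq_0_iff)
  then show ?thesis using False e by (simp add: nth_krylov)
qed (use i in \<open>simp add: nth_krylov\<close>)

text \<open>
  Two elements of \<open>H\<close> with the same cyclic tuple \<open>b\<close> and the same annihilator \<open>f\<close> agree on \<open>b\<close>, so
  they differ by an element of the pointwise stabilizer of \<open>b\<close>. The tuples \<open>b\<close> lie in one orbit,
  and orbit size times stabilizer size is the order of \<open>H\<close>. The proof makes this an injection into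
  \<open>H\<close>: with \<open>b0\<close> a base point, \<open>h b\<close> taking \<open>b0\<close> to \<open>b\<close>, and \<open>s b\<close> a chosen element with tuple \<open>b\<close>,
  send \<open>(g, v)\<close> to \<open>h b \<cdot> g \<cdot> (s b)\<^sup>-\<^sup>1\<close>. The image maps \<open>b0\<close> to \<open>b\<close>, so it
  determines \<open>b\<close> and hence \<open>g\<close>, while \<open>v\<close> is the first entry of \<open>b\<close>.
\<close>

lemma card_cyclic_pairs_le:
  fixes H :: "('a::{field,finite}^'n^'n) set"
  assumes H: "subgroup H GL" and len: "\<And>b. b \<in> B \<Longrightarrow> length b = e" and e: "e > 0"
    and trans: "\<And>b b'. b \<in> B \<Longrightarrow> b' \<in> B \<Longrightarrow> \<exists>h\<in>H. map (\<lambda>v. v v* h) b = b'"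
    and f: "lead_coeff f = 1" "degree f = e"
  shows "card {(g, v). g \<in> H \<and> krylov g v e \<in> B \<and> poly_apply g f v = 0} \<le> card H"
    (is "card ?X \<le> _")
proof (cases "?X = {}")
  case False
  then obtain b0 where b0: "b0 \<in> B" by auto
  define h where "h b = (SOME h. h \<in> H \<and> map (\<lambda>v. v v* h) b0 = b)" for b
  have h: "h b \<in> H" "map (\<lambda>v. v v* h b) b0 = b" if "b \<in> B" for b
    using someI_ex[of "\<lambda>h. h \<in> H \<and> map (\<lambda>v. v v* h) b0 = b"] trans[OF b0 that] unfolding h_def by blast+
  define s where "s b = (SOME g. \<exists>v. (g, v) \<in> ?X \<and> krylov g v e = b)" for b
  have s: "\<exists>v. (s b, v) \<in> ?X \<and> krylov (s b) v e = b" if "(g, v) \<in> ?X" "krylov g v e = b" for g v b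
    using someI_ex[of "\<lambda>g. \<exists>v. (g, v) \<in> ?X \<and> krylov g v e = b"] that unfolding s_def by blast
  define \<phi> where "\<phi> = (\<lambda>(g, v). let b = krylov g v e in h b ** g ** inv\<^bsub>GL\<^esub> (s b))"
  have Hinv: "invertible x" if "x \<in> H" for x using subgroup.subset[OF H] that by auto
  have key: "map (\<lambda>w. w v* \<phi> (g, v)) b0 = krylov g v e" "\<phi> (g, v) \<in> H" if gv: "(g, v) \<in> ?X" for g v
  proof -
    let ?b = "krylov g v e"
    obtain v' where v': "(s ?b, v') \<in> ?X" "krylov (s ?b) v' e = ?b" using s[OF gv refl] by auto
    have sH: "s ?b \<in> H" and b: "?b \<in> B" and gH: "g \<in> H" using v' gv by auto
    have "?b ! i v* g = ?b ! i v* s ?b" if "i < e" for i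
      using next_krylov[of f e g v i] next_krylov[of f e "s ?b" v' i] f gv v' that by simp
    then have "?b ! i v* (g ** inv\<^bsub>GL\<^esub> (s ?b)) = ?b ! i" if "i < e" for i
      using that Hinv[OF sH] by (simp add: vector_matrix_mul_assoc[symmetric])
        (simp add: vector_matrix_mul_assoc GL_inv)
    then have "map (\<lambda>w. w v* (g ** inv\<^bsub>GL\<^esub> (s ?b))) ?b = ?b" by (intro nth_equalityI) auto
    moreover have "map (\<lambda>w. w v* \<phi> (g, v)) b0 = map (\<lambda>w. w v* (g ** inv\<^bsub>GL\<^esub> (s ?b))) (map (\<lambda>w. w v* h ?b) b0)"
      by (simp add: \<phi>_def Let_def vector_matrix_mul_assoc matrix_mul_assoc)
    ultimately show "map (\<lambda>w. w v* \<phi> (g, v)) b0 = ?b" using h(2)[OF b] by simp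
    show "\<phi> (g, v) \<in> H"
      using subgroup.m_closed[OF H subgroup.m_closed[OF H h(1)[OF b] gH] subgroup.m_inv_closed[OF H sH]]
      by (simp add: \<phi>_def Let_def)
  qed
  have "inj_on \<phi> ?X"
  proof (rule inj_onI)
    fix x x' assume x: "x \<in> ?X" "x' \<in> ?X" "\<phi> x = \<phi> x'"
    obtain g v g' v' where gv: "x = (g, v)" "x' = (g', v')" by (meson surj_pair)
    then have X: "(g, v) \<in> ?X" "(g', v') \<in> ?X" and eq: "\<phi> (g, v) = \<phi> (g', v')" using x by auto
    let ?b = "krylov g v e"
    have b: "krylov g' v' e = ?b" using key(1)[OF X(1)] key(1)[OF X(2)] eq by simp
    have "v = ?b ! 0" "v' = ?b ! 0" using e nth_krylov[of 0 e g v] nth_krylov[of 0 e g' v'] b by auto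
    moreover have "g = g'"
    proof -
      have "?b \<in> B" using X by auto
      obtain w where "(s ?b, w) \<in> ?X" using s[OF X(1) refl] by auto
      then have si: "invertible (s ?b)" using Hinv by auto
      have hi: "invertible (h ?b)" using Hinv h(1)[OF \<open>?b \<in> B\<close>] by auto
      have *: "h ?b ** g ** inv\<^bsub>GL\<^esub> (s ?b) = h ?b ** g' ** inv\<^bsub>GL\<^esub> (s ?b)"
        using eq b by (simp add: \<phi>_def Let_def)
      have "inv\<^bsub>GL\<^esub> (h ?b) ** (h ?b ** g ** inv\<^bsub>GL\<^esub> (s ?b)) ** s ?b = g" for g
        using GL_inv[OF si] GL_inv[OF hi] by (metis matrix_mul_assoc matrix_mul_lid matrix_mul_rid)
      then show "g = g'" using * by metis
    qed
    ultimately show "x = x'" using gv by simp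
  qed
  then show ?thesis using key(2) by (intro card_inj_on_le[of \<phi>]) auto
next
  case True
  then show ?thesis by (simp only: card.empty)
qed

section \<open>Irreducible polynomials over a finite field\<close>

lemma card_degree_less:
  "finite {p::'a::{field,finite} poly. p = 0 \<or> degree p < e}"
  "card {p::'a::{field,finite} poly. p = 0 \<or> degree p < e} = CARD('a) ^ e"
proof -
  let ?L = "{xs::'a list. set xs \<subseteq> UNIV \<and> length xs = e}"
  let ?P = "{p::'a poly. p = 0 \<or> degree p < e}"
  have bij: "bij_betw Poly ?L ?P"
  proof (rule bij_betwI[where g = "\<lambda>p. map (coeff p) [0..<e]"])
    show "Poly \<in> ?L \<rightarrow> ?P"
      by (auto simp: coeff_Poly_eq nth_default_def intro!: degree_lessI)
    show "map (coeff (Poly xs)) [0..<e] = xs" if "xs \<in> ?L" for xs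
      using that by (intro nth_equalityI) (auto simp: nth_default_def)
    show "Poly (map (coeff p) [0..<e]) = p" if "p \<in> ?P" for p
      using that by (intro poly_eqI) (auto simp: nth_default_def coeff_eq_0)
  qed auto
  show "finite ?P" using bij_betw_finite[OF bij] finite_lists_length_eq[of "UNIV :: 'a set" e] by simp
  show "card ?P = CARD('a) ^ e"
    using bij_betw_same_card[OF bij] card_lists_length_eq[of "UNIV :: 'a set" e] by simp
qed

lemma prime_elem_dvd_prodE:
  fixes p :: "'a::field poly"
  assumes "prime_elem p" "finite S" "p dvd prod g S"
  obtains x where "x \<in> S" "p dvd g x"
proof -
  have "\<exists>x\<in>S. p dvd g x" using assms(2,3)
    by induction (use assms(1) in \<open>auto simp: prime_elem_dvd_mult_iff prime_elem_not_unit\<close>)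
  then show thesis using that by blast
qed

lemma card_field_ge_2: "CARD('a::{field,finite}) \<ge> 2"
  using card_mono[of "UNIV :: 'a set" "{0, 1}"] by simp

text \<open>
  This is Fermat's little theorem in the field of residues modulo \<open>f\<close>, applied to the residue of
  the variable: multiplication by it permutes the nonzero residues, so comparing the products of all
  nonzero residues before and after yields the claim.
\<close>

lemma irreducible_dvd_X_power_minus_1:
  fixes f :: "'a::{field,finite} poly"
  assumes f: "irreducible f" "degree f \<ge> 2"
  shows "f dvd monom 1 (CARD('a) ^ degree f - 1) - 1"
proof -
  let ?R = "{p::'a poly. p = 0 \<or> degree p < degree f}"
  let ?R' = "?R - {0}"
  define m where "m p = ([:0, 1:] * p) mod f" for p
  have prime: "prime_elem f" using f(1) by (rule field_poly_irreducible_imp_prime)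
  have small: "p = 0" if "f dvd p" "p = 0 \<or> degree p < degree f" for p
    using dvd_imp_degree_le[OF that(1)] that(2) by linarith
  have X: "\<not> f dvd [:0, 1:]"
  proof
    assume "f dvd [:0, 1:]"
    from dvd_imp_degree_le[OF this] f(2) show False by simp
  qed
  have fin: "finite ?R'" using card_degree_less(1) by blast
  have card: "card ?R' = CARD('a) ^ degree f - 1"
    using card_degree_less[where ?'a='a, of "degree f"] by (subst card_Diff_singleton) auto
  have into: "m p \<in> ?R'" if "p \<in> ?R'" for p
  proof -
    have "\<not> f dvd [:0, 1:] * p" using prime X small[of p] that prime_elem_dvd_mult_iff by blast
    then have "m p \<noteq> 0" by (simp add: m_def mod_eq_0_iff_dvd)
    moreover have "degree (m p) < degree f"
      using \<open>m p \<noteq> 0\<close> f(2) unfolding m_def by (intro degree_mod_less') auto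
    ultimately show ?thesis by simp
  qed
  have inj: "inj_on m ?R'"
  proof (rule inj_onI)
    fix p p' assume R: "p \<in> ?R'" "p' \<in> ?R'" and eq: "m p = m p'"
    have "f dvd [:0, 1:] * p - [:0, 1:] * p'"
      using eq unfolding m_def by (rule mod_eq_dvd_iff[THEN iffD1])
    then have "f dvd [:0, 1:] * (p - p')" by (simp only: right_diff_distrib)
    then have "f dvd p - p'" using prime X prime_elem_dvd_mult_iff by blast
    moreover have "degree (p - p') < degree f" using R by (intro degree_diff_less) auto
    ultimately show "p = p'" using small[of "p - p'"] by simp
  qed
  have "m ` ?R' = ?R'" using into by (intro endo_inj_surj fin inj) auto
  then have "(\<Prod>p\<in>?R'. p) = (\<Prod>p\<in>?R'. m p)"
    using prod.reindex[OF inj, of id] by simp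
  then have "(\<Prod>p\<in>?R'. p) mod f = (\<Prod>p\<in>?R'. [:0, 1:] * p) mod f"
    unfolding m_def by (simp only: mod_prod_eq)
  also have "(\<Prod>p\<in>?R'. [:0, 1:] * p) = monom 1 (card ?R') * (\<Prod>p\<in>?R'. p)"
    by (simp only: prod.distrib prod_constant monom_altdef smult_1_left)
  finally have "f dvd monom 1 (card ?R') * (\<Prod>p\<in>?R'. p) - (\<Prod>p\<in>?R'. p)"
    by (rule mod_eq_dvd_iff[THEN iffD1, OF sym])
  then have "f dvd (monom 1 (card ?R') - 1) * (\<Prod>p\<in>?R'. p)" by (simp only: left_diff_distrib mult_1)
  moreover have "\<not> f dvd (\<Prod>p\<in>?R'. p)" using small by (auto elim!: prime_elem_dvd_prodE[OF prime fin])
  ultimately show ?thesis unfolding card[symmetric] using prime_elem_dvd_mult_iff[OF prime] by blast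
qed

lemma prod_irreducible_dvd:
  fixes P :: "'a::field poly"
  assumes "finite S" "\<And>f. f \<in> S \<Longrightarrow> irreducible f \<and> lead_coeff f = 1 \<and> f dvd P"
  shows "\<Prod>S dvd P"
  using assms
proof (induction S)
  case (insert f S)
  then obtain r where r: "P = \<Prod>S * r" by (auto elim: dvdE)
  have prime: "prime_elem f" using insert.prems by (intro field_poly_irreducible_imp_prime) auto
  have "\<not> f dvd \<Prod>S"
  proof
    assume "f dvd \<Prod>S"
    then obtain f' where f': "f' \<in> S" "f dvd f'"
      by (rule prime_elem_dvd_prodE[OF prime insert.hyps(1)])
    then obtain u where u: "f' = f * u" by (auto elim: dvdE)
    have "is_unit u" using irreducibleD[OF _ u] prime insert.prems f'(1) by auto
    then obtain c where c: "u = [:c:]" by (metis is_unit_poly_iff)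
    moreover have "lead_coeff f' = lead_coeff f * lead_coeff u" unfolding u by (rule lead_coeff_mult)
    ultimately have "c = 1" using insert.prems f'(1) by auto
    then have "f' = f" using u c by simp
    then show False using f' insert.hyps by simp
  qed
  then have "f dvd r" using insert.prems[of f] r prime prime_elem_dvd_mult_iff by blast
  then show ?case using r insert.hyps by (simp add: mult.commute mult_dvd_mono)
qed simp

text \<open>
  Distinct monic irreducible polynomials of degree \<open>e\<close> are coprime divisors of the same polynomial
  of degree \<open>q ^ e - 1\<close>, so their degrees add up to at most that. The condition \<open>e \<ge> 2\<close> keeps out
  the linear polynomial with root 0, which does not divide it.
\<close>

lemma card_irreducible_le:
  assumes e: "e \<ge> 2"
  defines "I \<equiv> {f::'a::{field,finite} poly. lead_coeff f = 1 \<and> degree f = e \<and> irreducible f}"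
  shows "finite I" "e * card I \<le> CARD('a) ^ e - 1"
proof -
  have "I \<subseteq> {p. p = 0 \<or> degree p < Suc e}" by (auto simp: I_def)
  then show fin: "finite I" using card_degree_less(1) finite_subset by blast
  let ?N = "CARD('a) ^ e - 1"
  have "CARD('a) \<ge> 2" by (rule card_field_ge_2)
  then have N: "?N > 0" using e one_less_power[of "CARD('a)" e] by simp
  let ?P = "monom 1 ?N - 1 :: 'a poly"
  have "coeff ?P ?N = 1" using N by simp
  then have P: "?P \<noteq> 0" by (metis coeff_0 zero_neq_one)
  have "\<Prod>I dvd ?P"
    using irreducible_dvd_X_power_minus_1 e by (intro prod_irreducible_dvd fin) (auto simp: I_def)
  then have "degree (\<Prod>I) \<le> degree ?P" using P by (rule dvd_imp_degree_le)
  moreover have "degree (\<Prod>I) = e * card I"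
  proof -
    have "degree (prod (\<lambda>f. f) I) = (\<Sum>f\<in>I. degree f)"
      by (rule degree_prod_sum_eq) (auto simp: I_def)
    also have "\<dots> = (\<Sum>f\<in>I. e)" by (rule sum.cong) (auto simp: I_def)
    finally show ?thesis by simp
  qed
  moreover have "degree ?P \<le> ?N" by (intro degree_diff_le) (auto simp: degree_monom_le)
  ultimately show "e * card I \<le> ?N" by linarith
qed

section \<open>Fat elements in the stabilizer of a subspace\<close>

definition stabilizer :: "('a::field^'n^'n) set \<Rightarrow> ('a^'n) set \<Rightarrow> ('a^'n^'n) set" where
  "stabilizer G W = {g \<in> G. \<forall>w\<in>W. w v* g \<in> W}"

lemma subgroup_stabilizer:
  fixes G :: "('a::{field,finite}^'n^'n) set"
  assumes G: "subgroup G GL"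
  shows "subgroup (stabilizer G W) GL"
proof
  show "stabilizer G W \<subseteq> carrier GL" using subgroup.subset[OF G] by (auto simp: stabilizer_def)
  show "x \<otimes>\<^bsub>GL\<^esub> y \<in> stabilizer G W" if "x \<in> stabilizer G W" "y \<in> stabilizer G W" for x y
    using that subgroup.m_closed[OF G] by (simp add: stabilizer_def vector_matrix_mul_assoc[symmetric])
  show "\<one>\<^bsub>GL\<^esub> \<in> stabilizer G W" using subgroup.one_closed[OF G] by (simp add: stabilizer_def)
  show "inv\<^bsub>GL\<^esub> x \<in> stabilizer G W" if "x \<in> stabilizer G W" for x
  proof -
    have x: "x \<in> G" "\<forall>w\<in>W. w v* x \<in> W" using that by (auto simp: stabilizer_def)
    have "invertible x" using subgroup.subset[OF G] x(1) by auto
    from inv_preserves[OF this x(2)] show ?thesis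
      using subgroup.m_inv_closed[OF G x(1)] by (simp add: stabilizer_def)
  qed
qed

text \<open>
  Since \<open>SL\<close> is transitive on the subspaces of a given dimension, a stabilizer has at least as many
  disjoint cosets as there are such subspaces.
\<close>

lemma card_stabilizer_times_grassmannian_le:
  fixes G :: "('a::{field,finite}^'n^'n) set"
  assumes G: "subgroup G GL" "SL \<subseteq> G" and W: "W \<in> grassmannian k"
  shows "card (stabilizer G W) * card (grassmannian k :: ('a^'n) set set) \<le> card G"
proof -
  define h :: "('a^'n) set \<Rightarrow> 'a^'n^'n" where "h W' = (SOME h. h \<in> SL \<and> (\<forall>w\<in>W. w v* h \<in> W'))" for W'
  have h: "h W' \<in> SL" "\<forall>w\<in>W. w v* h W' \<in> W'" if "W' \<in> grassmannian k" for W'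
    using someI_ex[of "\<lambda>h. h \<in> SL \<and> (\<forall>w\<in>W. w v* h \<in> W')"] SL_maps_subspace[OF W that]
    unfolding h_def by blast+
  \<comment> \<open>The pair is recovered from its image: \<open>W'\<close> is where the product takes \<open>W\<close>.\<close>
  define \<phi> :: "('a^'n^'n) \<times> ('a^'n) set \<Rightarrow> 'a^'n^'n" where "\<phi> = (\<lambda>(x, W'). x ** h W')"
  have inv: "invertible x" if "x \<in> G" for x using subgroup.subset[OF G(1)] that by auto
  let ?S = "stabilizer G W \<times> (grassmannian k :: ('a^'n) set set)"
  have im: "\<phi> (x, W') \<in> G" "(\<lambda>w. w v* \<phi> (x, W')) ` W = W'"
    if x: "x \<in> stabilizer G W" "W' \<in> grassmannian k" for x W'
  proof -
    show "\<phi> (x, W') \<in> G" using subgroup.m_closed[OF G(1), of x "h W'"] h(1)[OF x(2)] x(1) G(2)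
      by (auto simp: \<phi>_def stabilizer_def)
    then have inj: "inj_on (\<lambda>w. w v* \<phi> (x, W')) W"
      using inj_vector_matrix[OF inv] inj_on_subset by blast
    have "(\<lambda>w. w v* \<phi> (x, W')) ` W \<subseteq> W'"
      using h(2)[OF x(2)] x(1) by (auto simp: \<phi>_def stabilizer_def vector_matrix_mul_assoc[symmetric])
    moreover have "card W = card W'" using W x(2) by (simp add: grassmannian_def card_subspace)
    ultimately show "(\<lambda>w. w v* \<phi> (x, W')) ` W = W'"
      using card_image[OF inj] by (intro card_subset_eq) auto
  qed
  have "inj_on \<phi> ?S"
  proof (rule inj_onI)
    fix p p' assume p: "p \<in> ?S" "p' \<in> ?S" "\<phi> p = \<phi> p'"
    obtain x W1 x' W2 where eq: "p = (x, W1)" "p' = (x', W2)" by (meson surj_pair)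
    have "W1 = W2" using im(2)[of x W1] im(2)[of x' W2] p eq by auto
    moreover have "invertible (h W1)" using inv h(1)[of W1] p eq G(2) by auto
    moreover have "x ** h W1 = x' ** h W1" using p(3) eq calculation(1) by (simp add: \<phi>_def)
    ultimately show "p = p'" using GL_inv(2)[of "h W1"] eq by (metis matrix_mul_assoc matrix_mul_rid)
  qed
  moreover have "\<phi> ` ?S \<subseteq> G" using im(1) by auto
  ultimately have "card ?S \<le> card G" by (rule card_inj_on_le) simp
  then show ?thesis by (simp add: card_cartesian_product)
qed

text \<open>
  The source of the factor \<open>1 / e\<close>. Each \<open>g\<close> in \<open>F\<close> is paired with the \<open>q ^ e - 1\<close> nonzero vectors of
  its irreducible submodule. Sorted by the annihilating polynomial, every irreducible
  polynomial accounts for at most \<open>|H|\<close> of these pairs, and there are at most \<open>(q ^ e - 1) / e\<close> such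
  polynomials.
\<close>

lemma card_irreducible_on_orbit_le:
  fixes H :: "('a::{field,finite}^'n^'n) set"
  assumes H: "subgroup H GL" and len: "\<And>b. b \<in> B \<Longrightarrow> length b = e" and e: "e \<ge> 2"
    and trans: "\<And>b b'. b \<in> B \<Longrightarrow> b' \<in> B \<Longrightarrow> \<exists>h\<in>H. map (\<lambda>v. v v* h) b = b'"
    and F: "\<And>g. g \<in> F \<Longrightarrow> g \<in> H \<and> (\<exists>U. irreducible_submodule (generate GL {g}) U \<and> vec.dim U = e
              \<and> (\<forall>v\<in>U. v \<noteq> 0 \<longrightarrow> krylov g v e \<in> B))"
  shows "e * card F \<le> card H"
proof -
  obtain U where U: "irreducible_submodule (generate GL {g}) (U g)" "vec.dim (U g) = e"
      "\<forall>v\<in>U g. v \<noteq> 0 \<longrightarrow> krylov g v e \<in> B" if "g \<in> F" for g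
    using F by metis
  have inv: "invertible g" if "g \<in> F" for g using F[OF that] subgroup.subset[OF H] by auto
  note sub = irreducible_submoduleD(1)[OF U(1) inv]
  \<comment> \<open>The fibre over \<open>f\<close> of the pairs in \<open>?S\<close> lies in \<open>?X f\<close>.\<close>
  let ?I = "{f::'a poly. lead_coeff f = 1 \<and> degree f = e \<and> irreducible f}"
  let ?X = "\<lambda>f. {(g, v). g \<in> H \<and> krylov g v e \<in> B \<and> poly_apply g f v = 0}"
  let ?S = "SIGMA g:F. U g - {0}"
  let ?N = "CARD('a) ^ e - 1"
  have "card (U g - {0}) = ?N" if "g \<in> F" for g
    using card_subspace[OF sub[OF that that]] U(2)[OF that] vec.subspace_0[OF sub[OF that that]]
    by (subst card_Diff_singleton) auto
  then have "card ?S = card F * ?N" by (subst card_SigmaI) auto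
  moreover have "?S \<subseteq> (\<Union>f\<in>?I. ?X f)"
  proof
    fix p assume "p \<in> ?S"
    then obtain g v where p: "p = (g, v)" and g: "g \<in> F" and v: "v \<in> U g" "v \<noteq> 0" by auto
    obtain f where "lead_coeff f = 1" "degree f = vec.dim (U g)" "irreducible f" "poly_apply g f v = 0"
      by (rule annihilator_of_irreducible[OF U(1)[OF g] inv[OF g] v])
    then show "p \<in> (\<Union>f\<in>?I. ?X f)" using U(2,3)[OF g] F[OF g] v p by auto
  qed
  then have "card ?S \<le> card (\<Union>f\<in>?I. ?X f)" by (rule card_mono[rotated]) simp
  moreover have "\<dots> \<le> (\<Sum>f\<in>?I. card (?X f))" by (rule card_UN_le) (rule card_irreducible_le(1)[OF e])
  moreover have "\<dots> \<le> (\<Sum>f\<in>?I. card H)"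
    using e by (intro sum_mono card_cyclic_pairs_le[OF H len _ trans]) auto
  ultimately have "card F * ?N \<le> card ?I * card H" by simp
  then have "e * (card F * ?N) \<le> e * (card ?I * card H)" by simp
  also have "\<dots> = (e * card ?I) * card H" by simp
  also have "\<dots> \<le> ?N * card H" by (intro mult_right_mono card_irreducible_le(2)[OF e]) simp
  finally have "?N * (e * card F) \<le> ?N * card H" by (simp add: ac_simps)
  moreover have "?N > 0" using card_field_ge_2[where ?'a='a] e one_less_power[of "CARD('a)" e] by simp
  ultimately show ?thesis by simp
qed

lemma indep_list_append:
  assumes "indep_list xs" "indep_list ys" "vec.span (set xs) \<inter> vec.span (set ys) \<subseteq> {0}"
  shows "indep_list (xs @ ys)"
  using assms(1,3)
proof (induction xs)
  case (Cons x xs)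
  have sub: "vec.span (set xs) \<subseteq> vec.span (set (x # xs))" by (rule vec.span_mono) auto
  have "x \<notin> vec.span (set xs \<union> set ys)"
  proof
    assume "x \<in> vec.span (set xs \<union> set ys)"
    then obtain s t where st: "x = s + t" "s \<in> vec.span (set xs)" "t \<in> vec.span (set ys)"
      by (auto simp: vec.span_Un)
    have "x \<in> vec.span (set (x # xs))" by (rule vec.span_base) simp
    then have "x - s \<in> vec.span (set (x # xs))" using st(2) sub by (intro vec.span_diff) auto
    then have "t = 0" using st Cons.prems(2) by auto
    then show False using st Cons.prems(1) by (simp add: indep_list_Cons)
  qed
  then show ?case using Cons sub by (auto simp: indep_list_Cons)
qed (use assms in simp)

lemma irreducible_inside_or_outside:
  fixes g :: "'a::{field,finite}^'n^'n"
  assumes irr: "irreducible_submodule (generate GL {g}) U" and g: "invertible g"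
    and W: "vec.subspace W" "\<forall>w\<in>W. w v* g \<in> W"
  shows "U \<subseteq> W \<or> U \<inter> W = {0}"
proof -
  note U = irreducible_submoduleD[OF irr g]
  have "U \<inter> W = {0} \<or> U \<inter> W = U"
    using U(3) W by (intro U(4) vec.subspace_inter U(1)) auto
  then show ?thesis by blast
qed

text \<open>
  An irreducible submodule of dimension \<open>e > d / 2\<close> lies inside \<open>W\<close>, forcing \<open>e \<le> k\<close>, or meets \<open>W\<close>
  trivially, forcing \<open>e \<le> d - k\<close>. Only one of the two can happen for given \<open>e\<close> and \<open>k\<close>, neither when
  \<open>2 * k = d\<close>, and in both \<open>e < d\<close>. The cyclic tuples are then independent inside \<open>W\<close>, respectively
  modulo \<open>W\<close>, and the stabilizer permutes such tuples transitively.
\<close>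

lemma card_irreducible_in_stabilizer_le:
  fixes G :: "('a::{field,finite}^'n^'n) set"
  assumes G: "subgroup G GL" "SL \<subseteq> G" and W: "W \<in> grassmannian k" "0 < k" "k < CARD('n)"
    and e: "e \<ge> 2" "CARD('n) < 2 * e"
  defines "F \<equiv> {g \<in> stabilizer G W. \<exists>U. irreducible_submodule (generate GL {g}) U \<and> vec.dim U = e}"
  shows "e * card F \<le> card (stabilizer G W)" "F \<noteq> {} \<Longrightarrow> e < CARD('n) \<and> 2 * k \<noteq> CARD('n)"
proof -
  let ?H = "stabilizer G W"
  have H: "subgroup ?H GL" by (rule subgroup_stabilizer[OF G(1)])
  have sub: "vec.subspace W" "vec.dim W = k" using W(1) by (auto simp: grassmannian_def)
  obtain ws where ws: "indep_list ws" "length ws = k" "vec.span (set ws) = W"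
    using subspace_basis_list[OF sub(1)] sub(2) by metis
  have F: "\<exists>U. irreducible_submodule (generate GL {g}) U \<and> vec.dim U = e \<and> g \<in> ?H \<and> invertible g
      \<and> (e \<le> k \<and> U \<subseteq> W \<or> e + k \<le> CARD('n) \<and> (\<forall>v\<in>U. v \<noteq> 0 \<longrightarrow> indep_list (ws @ krylov g v e)))"
    if gF: "g \<in> F" for g
  proof -
    obtain U where U: "irreducible_submodule (generate GL {g}) U" "vec.dim U = e" and gH: "g \<in> ?H"
      using gF by (auto simp: F_def)
    have g: "invertible g" using subgroup.subset[OF H] gH by auto
    note UD = irreducible_submoduleD[OF U(1) g]
    have "U \<subseteq> W \<or> U \<inter> W = {0}"
      using irreducible_inside_or_outside[OF U(1) g sub(1)] gH by (simp add: stabilizer_def)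
    then show ?thesis
    proof
      assume "U \<subseteq> W"
      moreover from this have "e \<le> k" using vec.dim_subset[of U W] U(2) sub(2) by simp
      ultimately show ?thesis using U gH g by blast
    next
      assume UW: "U \<inter> W = {0}"
      have ind: "indep_list (ws @ krylov g v e)" if "v \<in> U" "v \<noteq> 0" for v
        using krylov_basis_of_irreducible[OF U(1) g that] ws(1,3) UW U(2)
        by (intro indep_list_append) auto
      obtain v where v: "v \<in> U" "v \<noteq> 0" using UD(2) vec.subspace_0[OF UD(1)] by blast
      have "k + e \<le> CARD('n)"
        using indep_list_length_le[OF ind[OF v] subset_UNIV] ws(2) by (simp add: card_cart_basis)
      then have "e + k \<le> CARD('n)" by simp
      then show ?thesis using U gH g ind by blast
    qed
  qed
  show "e < CARD('n) \<and> 2 * k \<noteq> CARD('n)" if "F \<noteq> {}"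
  proof -
    obtain g where "g \<in> F" using \<open>F \<noteq> {}\<close> by auto
    then have "e \<le> k \<or> e + k \<le> CARD('n)" using F by blast
    then show ?thesis using W e by auto
  qed
  show "e * card F \<le> card ?H"
  proof (cases "e \<le> k")
    case True
    show ?thesis
    proof (rule card_irreducible_on_orbit_le[OF H _ e(1),
          where B = "{b. length b = e \<and> indep_list b \<and> set b \<subseteq> W}"])
      fix b b' assume b: "b \<in> {b. length b = e \<and> indep_list b \<and> set b \<subseteq> W}"
        "b' \<in> {b. length b = e \<and> indep_list b \<and> set b \<subseteq> W}"
      obtain h :: "'a^'n^'n" where h: "h \<in> SL" "\<forall>w\<in>W. w v* h \<in> W" "map (\<lambda>v. v v* h) b = b'"
        by (rule SL_stabilizer_transitive_inside[of W b b']) (use b sub W(3) in auto)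
      then show "\<exists>h\<in>?H. map (\<lambda>v. v v* h) b = b'" using G(2) by (auto simp: stabilizer_def)
    next
      fix g assume "g \<in> F"
      then obtain U where U: "irreducible_submodule (generate GL {g}) U" "vec.dim U = e" "U \<subseteq> W"
        "g \<in> ?H" "invertible g" using F[of g] True e(2) by auto
      note UD = irreducible_submoduleD[OF U(1,5)]
      have "indep_list (krylov g v e) \<and> set (krylov g v e) \<subseteq> W" if "v \<in> U" "v \<noteq> 0" for v
        using krylov_basis_of_irreducible(1)[OF U(1,5) that] krylov_preserved(2)[OF UD(3) that(1), of e] U(2,3)
        by auto
      then show "g \<in> ?H \<and> (\<exists>U. irreducible_submodule (generate GL {g}) U \<and> vec.dim U = e \<and>
        (\<forall>v\<in>U. v \<noteq> 0 \<longrightarrow> krylov g v e \<in> {b. length b = e \<and> indep_list b \<and> set b \<subseteq> W}))"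
        using U(1,2,4) by auto
    qed auto
  next
    case False
    show ?thesis
    proof (rule card_irreducible_on_orbit_le[OF H _ e(1),
          where B = "{b. length b = e \<and> indep_list (ws @ b)}"])
      fix b b' assume b: "b \<in> {b. length b = e \<and> indep_list (ws @ b)}"
        "b' \<in> {b. length b = e \<and> indep_list (ws @ b)}"
      have "ws \<noteq> []" using ws(2) W(2) by auto
      from SL_stabilizer_transitive_outside[OF ws(3) this, of b b']
      obtain h :: "'a^'n^'n" where h: "h \<in> SL" "\<forall>w\<in>W. w v* h \<in> W" "map (\<lambda>v. v v* h) b = b'"
        using b by auto
      then show "\<exists>h\<in>?H. map (\<lambda>v. v v* h) b = b'" using G(2) by (auto simp: stabilizer_def)
    next
      fix g assume "g \<in> F"
      then obtain U where U: "irreducible_submodule (generate GL {g}) U" "vec.dim U = e" "g \<in> ?H"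
        "\<forall>v\<in>U. v \<noteq> 0 \<longrightarrow> indep_list (ws @ krylov g v e)" using F[of g] False by auto
      then show "g \<in> ?H \<and> (\<exists>U. irreducible_submodule (generate GL {g}) U \<and> vec.dim U = e \<and>
        (\<forall>v\<in>U. v \<noteq> 0 \<longrightarrow> krylov g v e \<in> {b. length b = e \<and> indep_list (ws @ b)}))"
        by auto
    qed auto
  qed
qed

definition fat_stabilizer :: "('a::field^'n^'n) set \<Rightarrow> ('a^'n) set \<Rightarrow> ('a^'n^'n) set" where
  "fat_stabilizer G W = {g \<in> stabilizer G W. fat g}"

text \<open>
  The elements are sorted by the dimension \<open>e\<close> of a large irreducible submodule.
\<close>

lemma card_fat_stabilizer_le:
  fixes G :: "('a::{field,finite}^'n^'n) set"
  assumes G: "subgroup G GL" "SL \<subseteq> G" and d: "CARD('n) \<ge> 3"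
    and W: "W \<in> grassmannian k" "0 < k" "k < CARD('n)"
  shows "real (card (fat_stabilizer G W))
      \<le> (\<Sum>e | CARD('n) < 2 * e \<and> e < CARD('n). 1 / real e) * card (stabilizer G W)"
    "2 * k = CARD('n) \<Longrightarrow> fat_stabilizer G W = {}"
proof -
  let ?E = "{e. CARD('n) < 2 * e \<and> e < CARD('n)}"
  let ?F = "\<lambda>e. {g \<in> stabilizer G W. \<exists>U. irreducible_submodule (generate GL {g}) U \<and> vec.dim U = e}"
  have F: "e * card (?F e) \<le> card (stabilizer G W)"
    "?F e \<noteq> {} \<Longrightarrow> e < CARD('n) \<and> 2 * k \<noteq> CARD('n)" if "CARD('n) < 2 * e" for e
    by (rule card_irreducible_in_stabilizer_le[OF G W]; use that d in simp)+
  have cover: "\<exists>e\<in>?E. g \<in> ?F e \<and> 2 * k \<noteq> CARD('n)" if g: "g \<in> fat_stabilizer G W" for g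
  proof -
    obtain U where U: "irreducible_submodule (generate GL {g}) U" "real (vec.dim U) > real CARD('n) / 2"
      using g by (auto simp: fat_stabilizer_def fat_def)
    let ?e = "vec.dim U"
    have lt: "CARD('n) < 2 * ?e" using U(2) by linarith
    have mem: "g \<in> ?F ?e" using U(1) g by (auto simp: fat_stabilizer_def)
    have "?e < CARD('n) \<and> 2 * k \<noteq> CARD('n)" using mem by (intro F(2)[OF lt]) blast
    then show ?thesis using mem lt by (intro bexI[of _ ?e]) auto
  qed
  show "fat_stabilizer G W = {}" if "2 * k = CARD('n)" using cover that by blast
  have finE: "finite ?E" by (rule finite_subset[of _ "{..<CARD('n)}"]) auto
  have "card (fat_stabilizer G W) \<le> card (\<Union>e\<in>?E. ?F e)" using cover by (intro card_mono) auto
  also have "\<dots> \<le> (\<Sum>e\<in>?E. card (?F e))" by (rule card_UN_le[OF finE])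
  finally have "real (card (fat_stabilizer G W)) \<le> (\<Sum>e\<in>?E. real (card (?F e)))"
    unfolding of_nat_sum[symmetric] of_nat_le_iff .
  also have "\<dots> \<le> (\<Sum>e\<in>?E. 1 / real e * card (stabilizer G W))"
  proof (rule sum_mono)
    fix e assume "e \<in> ?E"
    then have e: "real e > 0" "real (e * card (?F e)) \<le> real (card (stabilizer G W))"
      using F(1)[of e] unfolding of_nat_le_iff by auto
    then show "real (card (?F e)) \<le> 1 / real e * card (stabilizer G W)"
      by (simp add: field_simps)
  qed
  finally show "real (card (fat_stabilizer G W)) \<le> (\<Sum>e\<in>?E. 1 / real e) * card (stabilizer G W)"
    by (simp add: sum_distrib_right)
qed

lemma reducible_pair_common_subspace:
  fixes g1 g2 :: "'a::{field,finite}^'n^'n"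
  assumes "reducible_pair g1 g2"
  obtains W k where "W \<in> grassmannian k" "0 < k" "k < CARD('n)"
    "\<forall>w\<in>W. w v* g1 \<in> W" "\<forall>w\<in>W. w v* g2 \<in> W"
proof -
  let ?H = "generate GL {g1, g2}"
  have inv: "invariant_submodule ?H UNIV" by (simp add: invariant_submodule_def)
  have "(UNIV :: ('a^'n) set) \<noteq> {0}"
  proof
    assume "(UNIV :: ('a^'n) set) = {0}"
    then have "axis undefined 1 = (0 :: 'a^'n)" by blast
    then show False by simp
  qed
  then obtain W where W: "invariant_submodule ?H W" "W \<noteq> {0}" "W \<noteq> UNIV"
    using assms inv unfolding reducible_pair_def irreducible_submodule_def by blast
  have sub: "vec.subspace W" and H: "\<forall>h\<in>?H. \<forall>w\<in>W. w v* h \<in> W"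
    using W(1) by (auto simp: invariant_submodule_def)
  have "\<not> W \<subseteq> {0}" using W(2) vec.subspace_0[OF sub] by blast
  then have pos: "0 < vec.dim W" using vec.dim_eq_0[of W] by blast
  have lt: "vec.dim W < CARD('n)"
  proof (rule ccontr)
    assume "\<not> ?thesis"
    then have "W = UNIV"
      using vec.subspace_dim_equal[OF sub vec.subspace_UNIV subset_UNIV] by (simp add: card_cart_basis)
    then show False using W(3) by simp
  qed
  show thesis
    by (rule that[of W "vec.dim W"])
      (use sub pos lt H generate.incl[of _ "{g1, g2}" GL] in \<open>auto simp: grassmannian_def\<close>)
qed

section \<open>Numerical estimates\<close>

text \<open>
  Every factor of the Gaussian binomial coefficient, \<open>(q ^ d - q ^ i) / (q ^ k - q ^ i)\<close>, is at least
  \<open>q ^ (d - k)\<close>.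
\<close>

lemma card_grassmannian_ge:
  assumes "k \<le> CARD('n)"
  shows "CARD('a) ^ (k * (CARD('n) - k)) \<le> card (grassmannian k :: ('a::{field,finite}^'n) set set)"
proof -
  let ?q = "CARD('a)" let ?d = "CARD('n)"
  let ?P = "\<Prod>i<k. ?q ^ k - ?q ^ i"
  have q: "?q > 1" using card_field_ge_2[where ?'a='a] by simp
  have "?q ^ (k * (?d - k)) * ?P = (\<Prod>i<k. ?q ^ (?d - k) * (?q ^ k - ?q ^ i))"
    by (simp add: prod.distrib power_mult mult.commute[of k])
  also have "\<dots> \<le> (\<Prod>i<k. ?q ^ ?d - ?q ^ i)"
  proof (rule prod_mono, safe)
    fix i
    have "?q ^ (?d - k) * (?q ^ k - ?q ^ i) = ?q ^ ?d - ?q ^ (?d - k) * ?q ^ i"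
      using assms by (simp add: diff_mult_distrib2 power_add[symmetric])
    also have "\<dots> \<le> ?q ^ ?d - ?q ^ i" using q by (intro diff_le_mono2) simp
    finally show "?q ^ (?d - k) * (?q ^ k - ?q ^ i) \<le> ?q ^ ?d - ?q ^ i" .
  qed
  also have "\<dots> = card (grassmannian k :: ('a^'n) set set) * ?P" by (simp add: card_grassmannian)
  finally show ?thesis using q by (auto simp: prod_pos power_strict_increasing)
qed

text \<open>
  For lines and hyperplanes the bound \<open>q ^ (d - 1)\<close> is too weak for the final sum, as these terms
  dominate; hence the exact value.
\<close>

lemma card_points_hyperplanes:
  assumes k: "k = 1 \<or> k = CARD('n) - 1"
  shows "real (card (grassmannian k :: ('a::{field,finite}^'n) set set)) * (real CARD('a) - 1)
    = real CARD('a) ^ CARD('n) - 1"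
proof -
  let ?c = "\<lambda>k. card (grassmannian k :: ('a^'n) set set)"
  define q where "q = real CARD('a)"
  define d where "d = CARD('n)"
  have d: "d > 0" by (simp add: d_def)
  have q: "q \<ge> 2" using card_field_ge_2[where ?'a='a] by (simp add: q_def)
  have gr: "real (?c k) * (\<Prod>i<k. q ^ k - q ^ i) = (\<Prod>i<k. q ^ d - q ^ i)" if "k \<le> d" for k
  proof -
    have "real (CARD('a) ^ m - CARD('a) ^ i) = q ^ m - q ^ i" if "i \<le> m" for m i
      using that card_field_ge_2[where ?'a='a] by (simp add: q_def of_nat_diff power_increasing)
    then show ?thesis
      using arg_cong[OF card_grassmannian[where ?'a='a and ?'n='n, of k], of real] that
      by (simp add: d_def)
  qed
  have "real (?c k) * (q - 1) = q ^ d - 1"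
    using k
  proof
    assume "k = 1"
    then show ?thesis using gr[of 1] d by simp
  next
    assume k: "k = CARD('n) - 1"
    then have dk: "d = Suc k" using d by (simp add: d_def)
    let ?P = "\<Prod>i<k. q ^ k - q ^ i"
    have P: "?P \<noteq> 0" using q by (auto simp: power_inject_exp)
    \<comment> \<open>The quotient of the two products telescopes: q ^ d - q ^ (i + 1) is q times q ^ k - q ^ i.\<close>
    have "(\<Prod>i<k. q ^ d - q ^ i) * (q ^ d - q ^ k) = (\<Prod>i<d. q ^ d - q ^ i)"
      by (simp add: dk)
    also have "\<dots> = (q ^ d - 1) * (\<Prod>i<k. q * (q ^ k - q ^ i))"
      unfolding dk by (subst prod.lessThan_Suc_shift) (simp add: right_diff_distrib)
    also have "\<dots> = (q ^ d - 1) * (q ^ k * ?P)" by (simp add: prod.distrib)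
    finally have "real (?c k) * ?P * (q ^ k * (q - 1)) = (q ^ d - 1) * (q ^ k * ?P)"
      using gr[of k] dk by (simp add: algebra_simps)
    then have "(q ^ k * ?P) * (real (?c k) * (q - 1)) = (q ^ k * ?P) * (q ^ d - 1)"
      by (simp add: ac_simps)
    then show ?thesis using P q by simp
  qed
  then show ?thesis by (simp add: q_def d_def)
qed

lemma sum_reciprocals_le_ln:
  "1 \<le> m \<Longrightarrow> m \<le> n \<Longrightarrow> (\<Sum>e\<in>{m<..n}. 1 / real e) \<le> ln n - ln m"
proof (induction n)
  case (Suc n)
  show ?case
  proof (cases "m = Suc n")
    case False
    then have mn: "m \<le> n" "n \<ge> 1" using Suc.prems by auto
    have "{m<..Suc n} = insert (Suc n) {m<..n}" using mn by auto
    then have "(\<Sum>e\<in>{m<..Suc n}. 1 / real e) = 1 / real (Suc n) + (\<Sum>e\<in>{m<..n}. 1 / real e)" by simp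
    moreover have "1 / real (Suc n) \<le> ln (real (Suc n)) - ln (real n)"
    proof -
      have "ln (real n / real (Suc n)) \<le> real n / real (Suc n) - 1"
        using mn by (intro ln_le_minus_one) simp
      moreover have "real n / real (Suc n) - 1 = - (1 / real (Suc n))" by (simp add: field_simps)
      moreover have "ln (real n / real (Suc n)) = ln (real n) - ln (real (Suc n))"
        using mn by (simp add: ln_div)
      ultimately show ?thesis by linarith
    qed
    ultimately show ?thesis using Suc.IH mn Suc.prems by simp
  qed simp
qed simp

text \<open>
  The harmonic sum over \<open>(d / 2, d - 1]\<close> is at most \<open>ln 2\<close>. What matters for the final estimate is
  that twice the square of the bound is below 1.
\<close>

lemma sum_upper_half_reciprocals_le:
  assumes "d \<ge> 3"
  shows "(\<Sum>e | d < 2 * e \<and> e < d. 1 / real e) \<le> 25 / 36"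
proof -
  let ?m = "d div 2"
  have "{e. d < 2 * e \<and> e < d} = {?m<..d - 1}" using assms by auto
  then have "(\<Sum>e | d < 2 * e \<and> e < d. 1 / real e) \<le> ln (real (d - 1)) - ln (real ?m)"
    using sum_reciprocals_le_ln[of ?m "d - 1"] assms by auto
  also have "\<dots> \<le> ln (real (2 * ?m)) - ln (real ?m)"
    using assms by (intro diff_right_mono ln_mono) auto
  also have "\<dots> = ln 2" using assms by (simp add: ln_mult)
  finally show ?thesis using ln2_le_25_over_36 by simp
qed

text \<open>
  The terms after the first sum to \<open>1 / (q\<^sup>2 - 1) \<le> 1 / (q + 1)\<close>, which is what the first term
  leaves up to 1. The induction carries the exact remainder of the geometric series.
\<close>

lemma sum_geometric_tail_le:
  fixes q :: real
  assumes q: "q \<ge> 2"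
  shows "(\<Sum>k<m. if k = 0 then q / (q + 1) else 1 / q ^ (2 * k)) \<le> 1"
proof -
  have sq: "q\<^sup>2 - 1 = (q - 1) * (q + 1)" by (simp add: power2_eq_square algebra_simps)
  have pos: "q\<^sup>2 - 1 > 0" unfolding sq using q by simp
  have "(\<Sum>k<Suc m. if k = 0 then q / (q + 1) else 1 / q ^ (2 * k))
      \<le> 1 - 1 / (q ^ (2 * m) * (q\<^sup>2 - 1))" for m
  proof (induction m)
    case 0
    have "1 * (q + 1) \<le> q\<^sup>2 - 1" unfolding sq using q by (intro mult_right_mono) auto
    then have "1 / (q\<^sup>2 - 1) \<le> 1 / (q + 1)" using q by (intro divide_left_mono) auto
    moreover have "q / (q + 1) = 1 - 1 / (q + 1)" using q by (simp add: field_simps)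
    ultimately show ?case by simp
  next
    case (Suc m)
    have "q ^ (2 * m) > 0" "q\<^sup>2 > 0" using q by auto
    then have "1 / (q ^ (2 * m) * (q\<^sup>2 - 1)) - 1 / (q ^ (2 * m) * q\<^sup>2)
        = 1 / ((q ^ (2 * m) * q\<^sup>2) * (q\<^sup>2 - 1))"
      using pos by (simp add: divide_simps)
    moreover have "q ^ (2 * Suc m) = q ^ (2 * m) * q\<^sup>2" by (simp add: power_add[symmetric])
    ultimately show ?case using Suc.IH
      by (simp only: sum.lessThan_Suc[of _ "Suc m"] nat.simps if_False)
  qed
  from this[of "m - 1"] pos q show ?thesis
    by (cases m) (auto intro: order_trans)
qed

lemma exponent_le:
  fixes k d :: nat
  assumes "2 \<le> k" "2 * k < d"
  shows "(d - 1) + 2 * (k - 1) \<le> k * (d - k)"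
proof -
  obtain j where j: "k = j + 2" using assms(1) le_Suc_ex by (metis add.commute)
  obtain r where r: "d = 2 * k + 1 + r" using assms(2) by (metis Suc_eq_plus1 Suc_leI le_Suc_ex)
  have "d - k = k + 1 + r" using r by simp
  then show ?thesis unfolding r j by (simp add: algebra_simps)
qed

text \<open>
  The index \<open>j\<close> is the smaller of \<open>k\<close> and \<open>d - k\<close>. For \<open>j = 1\<close> the exact count gains a factor
  \<open>(q + 1) / q\<close> over \<open>q ^ (d - 1)\<close>; for larger \<open>j\<close> the exponent \<open>j * (d - j)\<close> of the lower bound
  exceeds \<open>d - 1\<close> by at least \<open>2 * (j - 1)\<close>.
\<close>

lemma reciprocal_card_grassmannian_le:
  assumes j: "0 < j" "2 * j < CARD('n)" and k: "k = j \<or> k = CARD('n) - j"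
  shows "1 / real (card (grassmannian k :: ('a::{field,finite}^'n) set set))
    \<le> (if j = 1 then real CARD('a) / (real CARD('a) + 1) else 1 / real CARD('a) ^ (2 * (j - 1)))
      / real CARD('a) ^ (CARD('n) - 1)"
proof -
  define q where "q = real CARD('a)"
  define d where "d = CARD('n)"
  let ?c = "card (grassmannian k :: ('a^'n) set set)"
  have q: "q \<ge> 2" using card_field_ge_2[where ?'a='a] by (simp add: q_def)
  have kd: "k \<le> d" "k * (d - k) = j * (d - j)" using j k by (auto simp: d_def)
  have c: "q ^ (j * (d - j)) \<le> real ?c"
    using card_grassmannian_ge[where ?'a='a and ?'n='n, of k] kd
    unfolding q_def d_def by (metis of_nat_le_iff of_nat_power)
  have cpos: "real ?c > 0" using c q zero_less_power[of q] by (smt (verit))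
  have "1 / real ?c \<le> (if j = 1 then q / (q + 1) else 1 / q ^ (2 * (j - 1))) / q ^ (d - 1)"
  proof (cases "j = 1")
    case True
    have eq: "real ?c * (q - 1) = q ^ d - 1"
      using card_points_hyperplanes[where ?'a='a and ?'n='n, of k] k True by (simp add: q_def d_def)
    have qd: "q ^ d = q * q ^ (d - 1)" using j by (simp add: d_def power_eq_if)
    have "q ^ 1 \<le> q ^ (d - 1)" using q j by (intro power_increasing) (auto simp: d_def)
    then have "(q + 1) * q ^ (d - 1) * (q - 1) \<le> q * real ?c * (q - 1)"
    proof -
      have "(q + 1) * q ^ (d - 1) * (q - 1) = q * (q * q ^ (d - 1)) - q ^ (d - 1)"
        by (simp add: algebra_simps)
      moreover have "q * real ?c * (q - 1) = q * (q * q ^ (d - 1)) - q"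
        using arg_cong[OF eq, of "\<lambda>x. q * x"] unfolding qd
        by (simp only: mult.assoc right_diff_distrib mult_1_right)
      ultimately show ?thesis using \<open>q ^ 1 \<le> q ^ (d - 1)\<close> by simp
    qed
    then have "(q + 1) * q ^ (d - 1) \<le> q * real ?c" using q by simp
    then show ?thesis using True q cpos by (simp add: divide_simps mult.commute)
  next
    case False
    have "q ^ ((d - 1) + 2 * (j - 1)) \<le> q ^ (j * (d - j))"
      using q j False exponent_le[of j d] by (intro power_increasing) (auto simp: d_def)
    then have "q ^ (2 * (j - 1)) * q ^ (d - 1) \<le> real ?c"
      using c by (simp add: power_add mult.commute)
    then have "1 / real ?c \<le> 1 / (q ^ (2 * (j - 1)) * q ^ (d - 1))"
      using q cpos by (intro divide_left_mono mult_pos_pos) auto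
    then show ?thesis using False by simp
  qed
  then show ?thesis unfolding q_def d_def .
qed

text \<open>
  The dimensions \<open>k\<close> and \<open>d - k\<close> contribute alike, whence the factor 2; for \<open>k < d / 2\<close> the summands
  are dominated by the series of \<open>sum_geometric_tail_le\<close> with its index shifted by one.
\<close>

lemma sum_reciprocal_card_grassmannian_le:
  "(\<Sum>k | 0 < k \<and> k < CARD('n) \<and> 2 * k \<noteq> CARD('n).
      1 / real (card (grassmannian k :: ('a::{field,finite}^'n) set set)))
    \<le> 2 / real CARD('a) ^ (CARD('n) - 1)"
proof -
  define q where "q = real CARD('a)"
  define d where "d = CARD('n)"
  let ?r = "\<lambda>k. 1 / real (card (grassmannian k :: ('a^'n) set set))"
  let ?t = "\<lambda>k. (if k = 1 then q / (q + 1) else 1 / q ^ (2 * (k - 1))) / q ^ (d - 1)"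
  let ?A = "{k. 0 < k \<and> 2 * k < d}"
  have q: "q \<ge> 2" using card_field_ge_2[where ?'a='a] by (simp add: q_def)
  have r: "?r k \<le> ?t j" if "0 < j" "2 * j < d" "k = j \<or> k = d - j" for j k
    using reciprocal_card_grassmannian_le[where ?'a='a and ?'n='n, of j k] that
    unfolding q_def d_def by blast
  have split: "{k. 0 < k \<and> k < d \<and> 2 * k \<noteq> d} = ?A \<union> (\<lambda>k. d - k) ` ?A"
  proof (intro equalityI subsetI)
    fix k assume k: "k \<in> {k. 0 < k \<and> k < d \<and> 2 * k \<noteq> d}"
    show "k \<in> ?A \<union> (\<lambda>k. d - k) ` ?A"
    proof (cases "2 * k < d")
      case False
      then have "k = d - (d - k)" "d - k \<in> ?A" using k by auto
      then show ?thesis by blast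
    qed (use k in auto)
  qed auto
  have fin: "finite ?A" by (rule finite_subset[of _ "{..<d}"]) auto
  have inj: "inj_on (\<lambda>k. d - k) ?A" by (auto simp: inj_on_def)
  have "(\<Sum>k | 0 < k \<and> k < d \<and> 2 * k \<noteq> d. ?r k) = (\<Sum>k\<in>?A. ?r k) + (\<Sum>k\<in>?A. ?r (d - k))"
    unfolding split using fin by (subst sum.union_disjoint) (auto simp: sum.reindex[OF inj])
  also have "\<dots> \<le> (\<Sum>k\<in>?A. ?t k) + (\<Sum>k\<in>?A. ?t k)"
    by (intro add_mono sum_mono r) auto
  also have "(\<Sum>k\<in>?A. ?t k) = (\<Sum>k<(d - 1) div 2. if k = 0 then q / (q + 1) else 1 / q ^ (2 * k)) / q ^ (d - 1)"
  proof -
    have A: "?A = Suc ` {..<(d - 1) div 2}"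
    proof (intro equalityI subsetI)
      fix k assume "k \<in> ?A"
      then have "k = Suc (k - 1)" "k - 1 < (d - 1) div 2" by auto
      then show "k \<in> Suc ` {..<(d - 1) div 2}" by blast
    qed auto
    show ?thesis unfolding A by (simp add: sum.reindex sum_divide_distrib) (rule sum.cong; simp)
  qed
  also have "\<dots> \<le> 1 / q ^ (d - 1)"
    using sum_geometric_tail_le[OF q] q by (intro divide_right_mono) auto
  finally show ?thesis by (simp add: q_def d_def)
qed

section \<open>The proportion of reducible fat pairs\<close>

theorem theorem1p1:
  fixes G :: "('a::{field,finite}^'n^'n) set"
  assumes "CARD('n) \<ge> 3"
    and "subgroup G GL"
    and "SL \<subseteq> G"
  shows "reducible_fat_proportion G < real CARD('a) powi (- int CARD('n) + 1)"
proof -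
  define q where "q = real CARD('a)"
  define d where "d = CARD('n)"
  define p where "p = (\<Sum>e | d < 2 * e \<and> e < d. 1 / real e)"
  let ?K = "{k. 0 < k \<and> k < d \<and> 2 * k \<noteq> d}"
  let ?Gr = "\<lambda>k. grassmannian k :: ('a^'n) set set"
  let ?R = "{(g\<^sub>1, g\<^sub>2) \<in> G \<times> G. fat g\<^sub>1 \<and> fat g\<^sub>2 \<and> reducible_pair g\<^sub>1 g\<^sub>2}"
  let ?fs = "fat_stabilizer G"
  note G = assms(2,3)
  have q: "q \<ge> 2" using card_field_ge_2[where ?'a='a] by (simp add: q_def)
  have G_ne: "G \<noteq> {}" using subgroup.one_closed[OF G(1)] by auto
  have finK: "finite ?K" by (rule finite_subset[of _ "{..<d}"]) auto
  have p: "0 \<le> p" "p \<le> 25 / 36"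
    using sum_upper_half_reciprocals_le[OF assms(1)] by (auto simp: p_def d_def intro: sum_nonneg)
  have "?R \<subseteq> (\<Union>k\<in>?K. \<Union>W\<in>?Gr k. ?fs W \<times> ?fs W)"
  proof
    fix x assume x: "x \<in> ?R"
    then obtain g1 g2 where g: "x = (g1, g2)" "g1 \<in> G" "g2 \<in> G" "fat g1" "fat g2" "reducible_pair g1 g2"
      by auto
    obtain W k where W: "W \<in> ?Gr k" "0 < k" "k < CARD('n)"
      "\<forall>w\<in>W. w v* g1 \<in> W" "\<forall>w\<in>W. w v* g2 \<in> W"
      by (rule reducible_pair_common_subspace[OF g(6)])
    have mem: "g1 \<in> ?fs W" "g2 \<in> ?fs W" using g W by (auto simp: fat_stabilizer_def stabilizer_def)
    then have "2 * k \<noteq> CARD('n)" using card_fat_stabilizer_le(2)[OF G assms(1) W(1-3)] by auto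
    then show "x \<in> (\<Union>k\<in>?K. \<Union>W\<in>?Gr k. ?fs W \<times> ?fs W)" using W g mem by (auto simp: d_def)
  qed
  then have "card ?R \<le> card (\<Union>k\<in>?K. \<Union>W\<in>?Gr k. ?fs W \<times> ?fs W)" by (rule card_mono[rotated]) simp
  also have "\<dots> \<le> (\<Sum>k\<in>?K. card (\<Union>W\<in>?Gr k. ?fs W \<times> ?fs W))" by (rule card_UN_le[OF finK])
  also have "\<dots> \<le> (\<Sum>k\<in>?K. \<Sum>W\<in>?Gr k. card (?fs W \<times> ?fs W))"
    by (intro sum_mono card_UN_le) simp
  finally have "real (card ?R) \<le> real (\<Sum>k\<in>?K. \<Sum>W\<in>?Gr k. card (?fs W \<times> ?fs W))"
    by (rule of_nat_mono)
  also have "\<dots> = (\<Sum>k\<in>?K. \<Sum>W\<in>?Gr k. real (card (?fs W)) ^ 2)"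
    by (simp add: card_cartesian_product power2_eq_square)
  also have "\<dots> \<le> (\<Sum>k\<in>?K. (p * card G)\<^sup>2 * (1 / real (card (?Gr k))))"
  proof (rule sum_mono)
    fix k assume k: "k \<in> ?K"
    have c: "real (card (?Gr k)) > 0"
      using card_grassmannian_ge[where ?'a='a and ?'n='n, of k] k q
      by (auto simp: d_def card_gt_0_iff)
    have "(\<Sum>W\<in>?Gr k. real (card (?fs W)) ^ 2) \<le> (\<Sum>W\<in>?Gr k. (p * (card G / card (?Gr k)))\<^sup>2)"
    proof (intro sum_mono power_mono)
      fix W assume W: "W \<in> ?Gr k"
      have "card (stabilizer G W) * card (?Gr k) \<le> card G"
        by (rule card_stabilizer_times_grassmannian_le[OF G W])
      then have "real (card (stabilizer G W)) * real (card (?Gr k)) \<le> real (card G)"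
        unfolding of_nat_mult[symmetric] of_nat_le_iff .
      then have "real (card (stabilizer G W)) \<le> real (card G) / real (card (?Gr k))"
        using c by (simp add: pos_le_divide_eq)
      then have "p * real (card (stabilizer G W)) \<le> p * (real (card G) / real (card (?Gr k)))"
        using p by (intro mult_left_mono)
      moreover have "real (card (?fs W)) \<le> p * card (stabilizer G W)"
        using card_fat_stabilizer_le(1)[OF G assms(1) W] k by (simp add: p_def d_def)
      ultimately show "real (card (?fs W)) \<le> p * (card G / card (?Gr k))" by linarith
    qed simp
    also have "\<dots> = (p * card G)\<^sup>2 * (1 / real (card (?Gr k)))"
      using c by (simp add: power2_eq_square field_simps)
    finally show "(\<Sum>W\<in>?Gr k. real (card (?fs W)) ^ 2) \<le> (p * card G)\<^sup>2 * (1 / real (card (?Gr k)))" .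
  qed
  also have "\<dots> = (p * card G)\<^sup>2 * (\<Sum>k\<in>?K. 1 / real (card (?Gr k)))" by (rule sum_distrib_left[symmetric])
  also have "\<dots> \<le> (p * card G)\<^sup>2 * (2 / q ^ (d - 1))"
    using sum_reciprocal_card_grassmannian_le[where ?'a='a and ?'n='n]
    by (intro mult_left_mono) (auto simp: q_def d_def)
  finally have "real (card ?R) / real (card G) ^ 2 \<le> 2 * p\<^sup>2 / q ^ (d - 1)"
    using G_ne by (simp add: divide_le_eq power_mult_distrib mult.commute mult.left_commute)
  also have "\<dots> < 1 / q ^ (d - 1)"
  proof -
    have "p\<^sup>2 \<le> (25 / 36)\<^sup>2" using p by (intro power_mono) auto
    also have "\<dots> < 1 / 2" by (simp add: power2_eq_square)
    finally show ?thesis using q by (intro divide_strict_right_mono) auto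
  qed
  also have "\<dots> = q powi (- int d + 1)"
  proof -
    have "- int d + 1 = - int (d - 1)" using assms(1) by (simp add: d_def of_nat_diff)
    then show ?thesis by (simp only: power_int_minus power_int_of_nat inverse_eq_divide)
  qed
  finally show ?thesis unfolding reducible_fat_proportion_def q_def d_def .
qed

end
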